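(* Let $k$ be a field of characteristic $2$, let $\mathcal A$ be a commutative associative $k$-algebra and let $\mathcal D\subset\mathrm{Der}(\mathcal A)$ be a restricted Lie subalgebra (closed under commutator and under $f\mapsto f\circ f$). Then the space $\mathcal A\otimes\mathcal D$, with the bracket and $2$-map given by $$[a\otimes f,b\otimes g]=ab\otimes[f,g],\qquad(a\otimes f)^{[2]}=a^2\otimes f^2,$$ and the product $$(a\otimes f)\blacktriangleright(b\otimes g):=af(b)\otimes g,\qquad a,b\in\mathcal A,\ f,g\in\mathcal D,$$ is a trivially restricted post-Lie algebra.
   Context: $\mathrm{Der}(\mathcal A)$ is the space of derivations of $\mathcal A$, a restricted Lie algebra with commutator bracket and $p$-map $f\mapsto f^p$ (composition power). The $2$-map on $\mathcal A\otimes\mathcal D$ is the one given by the displayed formula on elementary tensors and extended to all elements by $(u+v)^{[2]}=u^{[2]}+v^{[2]}+[u,v]$. A post-Lie algebra is a Lie algebra $(\mathfrak g,[-,-])$ with a bilinear operation $\blacktriangleright$ such that for all $x,y,z$: $x\blacktriangleright[y,z]=[x\blacktriangleright y,z]+[y,x\blacktriangleright z]$ and $[x,y]\blacktriangleright z=a_\blacktriangleright(x,y,z)-a_\blacktriangleright(y,x,z)$, with $a_\blacktriangleright(x,y,z)=x\blacktriangleright(y\blacktriangleright z)-(x\blacktriangleright y)\blacktriangleright z$. In characteristic $2$, a trivially restricted post-Lie algebra is a tuple $(\mathfrak g,[-,-],(-)^{[2]},\blacktriangleright)$ such that $(\mathfrak g,[-,-],(-)^{[2]})$ is a restricted Lie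 algebra, $(\mathfrak g,[-,-],\blacktriangleright)$ is a post-Lie algebra, and for all $x,y\in\mathfrak g$: $x\blacktriangleright y^{[2]}=[x\blacktriangleright y,y]$ and $x^{[2]}\blacktriangleright y=x\blacktriangleright(x\blacktriangleright y)+(x\blacktriangleright x)\blacktriangleright y$. *)

theory Defs
  imports "HOL-Algebra.Algebra"
begin

section \<open>Bilinear operations and Lie algebras over a field\<close>

text \<open>
  The library record for modules extends the ring record, so it carries fields for a
  multiplication and a unit.  Where only a vector space is meant these two fields are
  never consulted.
\<close>

definition bilinear_op :: "('k, 'm) ring_scheme \<Rightarrow> ('k, 'l, 'n) module_scheme \<Rightarrow> ('l \<Rightarrow> 'l \<Rightarrow> 'l) \<Rightarrow> bool"
  where "bilinear_op R L m \<longleftrightarrow>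
    (\<forall>x\<in>carrier L. \<forall>y\<in>carrier L. m x y \<in> carrier L) \<and>
    (\<forall>x\<in>carrier L. \<forall>y\<in>carrier L. \<forall>z\<in>carrier L. m (x \<oplus>\<^bsub>L\<^esub> y) z = m x z \<oplus>\<^bsub>L\<^esub> m y z) \<and>
    (\<forall>x\<in>carrier L. \<forall>y\<in>carrier L. \<forall>z\<in>carrier L. m x (y \<oplus>\<^bsub>L\<^esub> z) = m x y \<oplus>\<^bsub>L\<^esub> m x z) \<and>
    (\<forall>c\<in>carrier R. \<forall>x\<in>carrier L. \<forall>y\<in>carrier L. m (c \<odot>\<^bsub>L\<^esub> x) y = c \<odot>\<^bsub>L\<^esub> m x y) \<and>
    (\<forall>c\<in>carrier R. \<forall>x\<in>carrier L. \<forall>y\<in>carrier L. m x (c \<odot>\<^bsub>L\<^esub> y) = c \<odot>\<^bsub>L\<^esub> m x y)"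

locale lie_algebra = module R L for R (structure) and L (structure) +
  fixes br :: "'c \<Rightarrow> 'c \<Rightarrow> 'c"
  assumes field_R: "field R"
    and br_bilinear: "bilinear_op R L br"
    and br_alternating: "x \<in> carrier L \<Longrightarrow> br x x = \<zero>\<^bsub>L\<^esub>"
    and br_jacobi: "\<lbrakk>x \<in> carrier L; y \<in> carrier L; z \<in> carrier L\<rbrakk> \<Longrightarrow>
      br x (br y z) \<oplus>\<^bsub>L\<^esub> br y (br z x) \<oplus>\<^bsub>L\<^esub> br z (br x y) = \<zero>\<^bsub>L\<^esub>"

text \<open>
  For \<open>p = 2\<close> the only Jacobson polynomial is \<open>s\<^sub>1(x,y) = [x,y]\<close>, so the axioms of a
  \<open>p\<close>-map specialise to the following.
\<close>

locale restricted_lie_algebra2 = lie_algebra +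
  fixes sq :: "'c \<Rightarrow> 'c"
  assumes char_2: "\<one> \<oplus> \<one> = \<zero>"
    and sq_closed: "x \<in> carrier L \<Longrightarrow> sq x \<in> carrier L"
    and sq_smult: "\<lbrakk>c \<in> carrier R; x \<in> carrier L\<rbrakk> \<Longrightarrow> sq (c \<odot>\<^bsub>L\<^esub> x) = (c \<otimes> c) \<odot>\<^bsub>L\<^esub> sq x"
    and sq_add: "\<lbrakk>x \<in> carrier L; y \<in> carrier L\<rbrakk> \<Longrightarrow>
      sq (x \<oplus>\<^bsub>L\<^esub> y) = sq x \<oplus>\<^bsub>L\<^esub> sq y \<oplus>\<^bsub>L\<^esub> br x y"
    and sq_ad: "\<lbrakk>x \<in> carrier L; y \<in> carrier L\<rbrakk> \<Longrightarrow> br (sq x) y = br x (br x y)"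

definition tri_associator :: "('l, 'm) ring_scheme \<Rightarrow> ('l \<Rightarrow> 'l \<Rightarrow> 'l) \<Rightarrow> 'l \<Rightarrow> 'l \<Rightarrow> 'l \<Rightarrow> 'l"
  where "tri_associator L tri x y z = tri x (tri y z) \<ominus>\<^bsub>L\<^esub> tri (tri x y) z"

locale post_lie_algebra = lie_algebra +
  fixes tri :: "'c \<Rightarrow> 'c \<Rightarrow> 'c"
  assumes tri_bilinear: "bilinear_op R L tri"
    and tri_br_right: "\<lbrakk>x \<in> carrier L; y \<in> carrier L; z \<in> carrier L\<rbrakk> \<Longrightarrow>
      tri x (br y z) = br (tri x y) z \<oplus>\<^bsub>L\<^esub> br y (tri x z)"
    and tri_br_left: "\<lbrakk>x \<in> carrier L; y \<in> carrier L; z \<in> carrier L\<rbrakk> \<Longrightarrow>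
      tri (br x y) z = tri_associator L tri x y z \<ominus>\<^bsub>L\<^esub> tri_associator L tri y x z"

locale trivially_restricted_post_lie_algebra2 =
  restricted_lie_algebra2 R L br sq + post_lie_algebra R L br tri
  for R (structure) and L (structure) and br sq tri +
  assumes tri_sq_right: "\<lbrakk>x \<in> carrier L; y \<in> carrier L\<rbrakk> \<Longrightarrow> tri x (sq y) = br (tri x y) y"
    and tri_sq_left: "\<lbrakk>x \<in> carrier L; y \<in> carrier L\<rbrakk> \<Longrightarrow>
      tri (sq x) y = tri x (tri x y) \<oplus>\<^bsub>L\<^esub> tri (tri x x) y"


section \<open>Commutative associative algebras and their derivations\<close>

text \<open>
  No unit is required, so the locale below is weaker than the library locale \<open>algebra\<close>
  (the field for the unit in the record is ignored).
\<close>

locale comm_assoc_algebra = module R A for R (structure) and A (structure) +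
  assumes a_mult_closed: "\<lbrakk>x \<in> carrier A; y \<in> carrier A\<rbrakk> \<Longrightarrow> x \<otimes>\<^bsub>A\<^esub> y \<in> carrier A"
    and a_mult_assoc: "\<lbrakk>x \<in> carrier A; y \<in> carrier A; z \<in> carrier A\<rbrakk> \<Longrightarrow>
      (x \<otimes>\<^bsub>A\<^esub> y) \<otimes>\<^bsub>A\<^esub> z = x \<otimes>\<^bsub>A\<^esub> (y \<otimes>\<^bsub>A\<^esub> z)"
    and a_mult_comm: "\<lbrakk>x \<in> carrier A; y \<in> carrier A\<rbrakk> \<Longrightarrow> x \<otimes>\<^bsub>A\<^esub> y = y \<otimes>\<^bsub>A\<^esub> x"
    and a_distr: "\<lbrakk>x \<in> carrier A; y \<in> carrier A; z \<in> carrier A\<rbrakk> \<Longrightarrow>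
      (x \<oplus>\<^bsub>A\<^esub> y) \<otimes>\<^bsub>A\<^esub> z = x \<otimes>\<^bsub>A\<^esub> z \<oplus>\<^bsub>A\<^esub> y \<otimes>\<^bsub>A\<^esub> z"
    and a_smult_assoc: "\<lbrakk>c \<in> carrier R; x \<in> carrier A; y \<in> carrier A\<rbrakk> \<Longrightarrow>
      (c \<odot>\<^bsub>A\<^esub> x) \<otimes>\<^bsub>A\<^esub> y = c \<odot>\<^bsub>A\<^esub> (x \<otimes>\<^bsub>A\<^esub> y)"

lemma algebra_imp_comm_assoc_algebra:
  assumes "algebra R A"
  shows "comm_assoc_algebra R A"
proof -
  interpret A: cring A
    using assms by (rule algebra.M_cring)
  show ?thesis
  proof (intro comm_assoc_algebra.intro algebra.module [OF assms] comm_assoc_algebra_axioms.intro)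
    show "x \<otimes>\<^bsub>A\<^esub> y = y \<otimes>\<^bsub>A\<^esub> x" if "x \<in> carrier A" "y \<in> carrier A" for x y
      using that by (rule A.m_comm)
  qed (simp_all add: A.m_assoc A.l_distr algebra.smult_assoc2 [OF assms])
qed

text \<open>
  Endomaps of \<open>A\<close> are extensional functions, so that equality of functions is equality
  on the carrier.
\<close>

definition derivations :: "('k, 'm) ring_scheme \<Rightarrow> ('k, 'a, 'n) module_scheme \<Rightarrow> ('a \<Rightarrow> 'a) set"
  where "derivations R A = {f \<in> carrier A \<rightarrow>\<^sub>E carrier A.
    (\<forall>x\<in>carrier A. \<forall>y\<in>carrier A. f (x \<oplus>\<^bsub>A\<^esub> y) = f x \<oplus>\<^bsub>A\<^esub> f y) \<and>
    (\<forall>c\<in>carrier R. \<forall>x\<in>carrier A. f (c \<odot>\<^bsub>A\<^esub> x) = c \<odot>\<^bsub>A\<^esub> f x) \<and>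
    (\<forall>x\<in>carrier A. \<forall>y\<in>carrier A. f (x \<otimes>\<^bsub>A\<^esub> y) = f x \<otimes>\<^bsub>A\<^esub> y \<oplus>\<^bsub>A\<^esub> x \<otimes>\<^bsub>A\<^esub> f y)}"

definition derivation_space ::
    "('k, 'm) ring_scheme \<Rightarrow> ('k, 'a, 'n) module_scheme \<Rightarrow> ('k, 'a \<Rightarrow> 'a) module"
  where "derivation_space R A =
    \<lparr>carrier = derivations R A,
     monoid.mult = compose (carrier A),
     one = (\<lambda>x\<in>carrier A. x),
     ring.zero = (\<lambda>x\<in>carrier A. \<zero>\<^bsub>A\<^esub>),
     add = (\<lambda>f g. \<lambda>x\<in>carrier A. f x \<oplus>\<^bsub>A\<^esub> g x),
     smult = (\<lambda>c f. \<lambda>x\<in>carrier A. c \<odot>\<^bsub>A\<^esub> f x)\<rparr>"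

definition commutator :: "('k, 'a, 'n) module_scheme \<Rightarrow> ('a \<Rightarrow> 'a) \<Rightarrow> ('a \<Rightarrow> 'a) \<Rightarrow> ('a \<Rightarrow> 'a)"
  where "commutator A f g = (\<lambda>x\<in>carrier A. f (g x) \<ominus>\<^bsub>A\<^esub> g (f x))"

locale restricted_lie_subalgebra_Der2 =
  submodule D R "derivation_space R A" for D R A +
  assumes commutator_closed: "\<lbrakk>f \<in> D; g \<in> D\<rbrakk> \<Longrightarrow> commutator A f g \<in> D"
    and square_closed: "f \<in> D \<Longrightarrow> compose (carrier A) f f \<in> D"


section \<open>Tensor products of modules\<close>

text \<open>
  The tensor product over \<open>R\<close> is the free abelian group on \<open>carrier M \<times> carrier N\<close> modulo
  the usual relations; its elements are cosets.
\<close>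

definition tensor_relations ::
    "('k, 'm) ring_scheme \<Rightarrow> ('k, 'a, 'n) module_scheme \<Rightarrow> ('k, 'b, 'o) module_scheme \<Rightarrow>
     ('a \<times> 'b \<Rightarrow>\<^sub>0 int) set"
  where "tensor_relations R M N =
    {frag_of (x \<oplus>\<^bsub>M\<^esub> x', y) - frag_of (x, y) - frag_of (x', y) | x x' y.
       x \<in> carrier M \<and> x' \<in> carrier M \<and> y \<in> carrier N} \<union>
    {frag_of (x, y \<oplus>\<^bsub>N\<^esub> y') - frag_of (x, y) - frag_of (x, y') | x y y'.
       x \<in> carrier M \<and> y \<in> carrier N \<and> y' \<in> carrier N} \<union>
    {frag_of (c \<odot>\<^bsub>M\<^esub> x, y) - frag_of (x, c \<odot>\<^bsub>N\<^esub> y) | c x y.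
       c \<in> carrier R \<and> x \<in> carrier M \<and> y \<in> carrier N}"

definition tensor_kernel ::
    "('k, 'm) ring_scheme \<Rightarrow> ('k, 'a, 'n) module_scheme \<Rightarrow> ('k, 'b, 'o) module_scheme \<Rightarrow>
     ('a \<times> 'b \<Rightarrow>\<^sub>0 int) set"
  where "tensor_kernel R M N =
    generate (free_Abelian_group (carrier M \<times> carrier N)) (tensor_relations R M N)"

definition tensor_class ::
    "('k, 'm) ring_scheme \<Rightarrow> ('k, 'a, 'n) module_scheme \<Rightarrow> ('k, 'b, 'o) module_scheme \<Rightarrow>
     ('a \<times> 'b \<Rightarrow>\<^sub>0 int) \<Rightarrow> ('a \<times> 'b \<Rightarrow>\<^sub>0 int) set"
  where "tensor_class R M N u =
    tensor_kernel R M N #>\<^bsub>free_Abelian_group (carrier M \<times> carrier N)\<^esub> u"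

definition tensor ::
    "('k, 'm) ring_scheme \<Rightarrow> ('k, 'a, 'n) module_scheme \<Rightarrow> ('k, 'b, 'o) module_scheme \<Rightarrow>
     'a \<Rightarrow> 'b \<Rightarrow> ('a \<times> 'b \<Rightarrow>\<^sub>0 int) set"
  where "tensor R M N x y = tensor_class R M N (frag_of (x, y))"

text \<open>
  The scalar \<open>c\<close> acts by \<open>c(x \<otimes> y) = (cx) \<otimes> y\<close>, extended additively to representatives.  The
  multiplication and unit of the record have no meaning here.
\<close>

definition tensor_product ::
    "('k, 'm) ring_scheme \<Rightarrow> ('k, 'a, 'n) module_scheme \<Rightarrow> ('k, 'b, 'o) module_scheme \<Rightarrow>
     ('k, ('a \<times> 'b \<Rightarrow>\<^sub>0 int) set) module"
  where "tensor_product R M N =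
    (let G = free_Abelian_group (carrier M \<times> carrier N) Mod tensor_kernel R M N in
     \<lparr>carrier = carrier G,
      monoid.mult = (\<lambda>_ _. undefined),
      one = undefined,
      ring.zero = \<one>\<^bsub>G\<^esub>,
      add = (\<lambda>U V. U \<otimes>\<^bsub>G\<^esub> V),
      smult = (\<lambda>c U. \<Union>u\<in>U. tensor_class R M N
        (frag_extend (\<lambda>(x, y). frag_of (c \<odot>\<^bsub>M\<^esub> x, y)) u))\<rparr>)"


section \<open>The operations on the tensor product of an algebra with its derivations\<close>

definition subspace_of_Der ::
    "('k, 'm) ring_scheme \<Rightarrow> ('k, 'a, 'n) module_scheme \<Rightarrow> ('a \<Rightarrow> 'a) set \<Rightarrow> ('k, 'a \<Rightarrow> 'a) module"
  where "subspace_of_Der R A D = (derivation_space R A)\<lparr>carrier := D\<rparr>"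

definition tensor_Der ::
    "('k, 'm) ring_scheme \<Rightarrow> ('k, 'a, 'n) module_scheme \<Rightarrow> ('a \<Rightarrow> 'a) set \<Rightarrow>
     ('k, ('a \<times> ('a \<Rightarrow> 'a) \<Rightarrow>\<^sub>0 int) set) module"
  where "tensor_Der R A D = tensor_product R A (subspace_of_Der R A D)"

abbreviation elem_tensor ::
    "('k, 'm) ring_scheme \<Rightarrow> ('k, 'a, 'n) module_scheme \<Rightarrow> ('a \<Rightarrow> 'a) set \<Rightarrow>
     'a \<Rightarrow> ('a \<Rightarrow> 'a) \<Rightarrow> ('a \<times> ('a \<Rightarrow> 'a) \<Rightarrow>\<^sub>0 int) set"
  where "elem_tensor R A D a f \<equiv> tensor R A (subspace_of_Der R A D) a f"

text \<open>
  The formulas prescribe the operations on elementary tensors only: bracket and product are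
  their bilinear extensions, and the 2-map is extended by
  \<open>(u + v)\<^sup>[\<^sup>2\<^sup>] = u\<^sup>[\<^sup>2\<^sup>] + v\<^sup>[\<^sup>2\<^sup>] + [u,v]\<close>.
\<close>

definition tensor_Der_operations ::
    "('k, 'm) ring_scheme \<Rightarrow> ('k, 'a, 'n) module_scheme \<Rightarrow> ('a \<Rightarrow> 'a) set \<Rightarrow>
     (('a \<times> ('a \<Rightarrow> 'a) \<Rightarrow>\<^sub>0 int) set \<Rightarrow> ('a \<times> ('a \<Rightarrow> 'a) \<Rightarrow>\<^sub>0 int) set \<Rightarrow> ('a \<times> ('a \<Rightarrow> 'a) \<Rightarrow>\<^sub>0 int) set) \<Rightarrow>
     (('a \<times> ('a \<Rightarrow> 'a) \<Rightarrow>\<^sub>0 int) set \<Rightarrow> ('a \<times> ('a \<Rightarrow> 'a) \<Rightarrow>\<^sub>0 int) set) \<Rightarrow>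
     (('a \<times> ('a \<Rightarrow> 'a) \<Rightarrow>\<^sub>0 int) set \<Rightarrow> ('a \<times> ('a \<Rightarrow> 'a) \<Rightarrow>\<^sub>0 int) set \<Rightarrow> ('a \<times> ('a \<Rightarrow> 'a) \<Rightarrow>\<^sub>0 int) set) \<Rightarrow>
     bool"
  where "tensor_Der_operations R A D br sq tri \<longleftrightarrow>
    bilinear_op R (tensor_Der R A D) br \<and>
    (\<forall>a\<in>carrier A. \<forall>f\<in>D. \<forall>b\<in>carrier A. \<forall>g\<in>D.
      br (elem_tensor R A D a f) (elem_tensor R A D b g) =
        elem_tensor R A D (a \<otimes>\<^bsub>A\<^esub> b) (commutator A f g)) \<and>
    (\<forall>u\<in>carrier (tensor_Der R A D). sq u \<in> carrier (tensor_Der R A D)) \<and>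
    (\<forall>a\<in>carrier A. \<forall>f\<in>D.
      sq (elem_tensor R A D a f) = elem_tensor R A D (a \<otimes>\<^bsub>A\<^esub> a) (compose (carrier A) f f)) \<and>
    (\<forall>u\<in>carrier (tensor_Der R A D). \<forall>v\<in>carrier (tensor_Der R A D).
      sq (u \<oplus>\<^bsub>tensor_Der R A D\<^esub> v) =
        sq u \<oplus>\<^bsub>tensor_Der R A D\<^esub> sq v \<oplus>\<^bsub>tensor_Der R A D\<^esub> br u v) \<and>
    bilinear_op R (tensor_Der R A D) tri \<and>
    (\<forall>a\<in>carrier A. \<forall>f\<in>D. \<forall>b\<in>carrier A. \<forall>g\<in>D.
      tri (elem_tensor R A D a f) (elem_tensor R A D b g) =
        elem_tensor R A D (a \<otimes>\<^bsub>A\<^esub> f b) g)"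

end

theory Submission
  imports Defs
begin

text \<open>
  Everything reduces to elementary tensors once the operations are known to exist, because the
  axioms that are linear in each argument propagate along sums, and the defects of the axioms
  involving the 2-map are governed by their polarisations: these are the Jacobi identity and the
  two post-Lie axioms, with signs dropped in characteristic 2.  On elementary tensors the axioms
  are identities for derivations, e.g. \<open>f(b\<^sup>2) = 2b f(b) = 0\<close> gives
  \<open>x \<rhd> y\<^sup>[\<^sup>2\<^sup>] = 0 = [x \<rhd> y, y]\<close>.

  The only subtle existence question is that of the 2-map, which is quadratic rather than linear.
  On the free abelian group on pairs it is obtained as \<open>u \<mapsto> e(u,u)\<close> for a non-symmetric
  bilinear form \<open>e\<close> with \<open>e(u,v) + e(v,u)\<close> representing the bracket; such a map descends to
  the quotient as soon as it vanishes on the defining relations.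
\<close>

section \<open>Tensor products of modules\<close>

lemma keys_add_subset:
  "\<lbrakk>Poly_Mapping.keys u \<subseteq> S; Poly_Mapping.keys v \<subseteq> S\<rbrakk> \<Longrightarrow> Poly_Mapping.keys (u + v) \<subseteq> S"
  using keys_add [of u v] by blast

text \<open>Scalars act on the tensor product through the left factor, so \<open>M\<close> carries
  the module structure while \<open>N\<close> supplies closed operations. An element of
  \<open>N\<close> is required because zero is later written as an elementary tensor with left entry
  zero.\<close>

locale tensor_modules = module R M for R (structure) and M (structure) +
  fixes N :: "('a, 'e, 'f) module_scheme"
  assumes N_add_closed: "\<lbrakk>y \<in> carrier N; y' \<in> carrier N\<rbrakk> \<Longrightarrow> y \<oplus>\<^bsub>N\<^esub> y' \<in> carrier N"
    and N_smult_closed: "\<lbrakk>c \<in> carrier R; y \<in> carrier N\<rbrakk> \<Longrightarrow> c \<odot>\<^bsub>N\<^esub> y \<in> carrier N"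
    and N_nonempty: "carrier N \<noteq> {}"
begin

abbreviation "F \<equiv> free_Abelian_group (carrier M \<times> carrier N)"
abbreviation "K \<equiv> tensor_kernel R M N"
abbreviation "cls \<equiv> tensor_class R M N"
abbreviation "T \<equiv> tensor_product R M N"
abbreviation "tns \<equiv> tensor R M N"

section \<open>The subgroup of tensor relations and its cosets\<close>

lemma tensor_relations_subset: "tensor_relations R M N \<subseteq> carrier F"
  by (auto simp: tensor_relations_def N_add_closed N_smult_closed M.a_closed
      dest!: subsetD [OF keys_diff] split: if_splits)

lemma subgroup_tensor_kernel: "subgroup K F"
  unfolding tensor_kernel_def
  by (rule group.generate_is_subgroup [OF group_free_Abelian_group tensor_relations_subset])

lemma normal_tensor_kernel: "K \<lhd> F"
  by (rule comm_group.subgroup_imp_normal [OF abelian_free_Abelian_group subgroup_tensor_kernel])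

lemma tensor_kernel_zero: "0 \<in> K"
  using subgroup.one_closed [OF subgroup_tensor_kernel] by simp

lemma tensor_kernel_add: "\<lbrakk>u \<in> K; v \<in> K\<rbrakk> \<Longrightarrow> u + v \<in> K"
  using subgroup.m_closed [OF subgroup_tensor_kernel] by simp

lemma tensor_kernel_keys: "u \<in> K \<Longrightarrow> Poly_Mapping.keys u \<subseteq> carrier M \<times> carrier N"
  using subgroup.mem_carrier [OF subgroup_tensor_kernel] by simp

lemma tensor_kernel_uminus: "u \<in> K \<Longrightarrow> - u \<in> K"
  using subgroup.m_inv_closed [OF subgroup_tensor_kernel] tensor_kernel_keys by fastforce

lemma tensor_kernel_diff: "\<lbrakk>u \<in> K; v \<in> K\<rbrakk> \<Longrightarrow> u - v \<in> K"
  using tensor_kernel_add [of u "- v"] tensor_kernel_uminus [of v] by simp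

lemma tensor_relations_in_kernel: "r \<in> tensor_relations R M N \<Longrightarrow> r \<in> K"
  unfolding tensor_kernel_def by (rule generate.incl)

text \<open>Inverses of generators form a separate case of \<open>generate\<close>; here they are
  absorbed into closure under negation, so only the defining relations have to be checked.\<close>

lemma tensor_kernel_induct [consumes 1, case_names zero rel minus add]:
  assumes "u \<in> K" and "P 0" and rel: "\<And>r. r \<in> tensor_relations R M N \<Longrightarrow> P r"
    and minus: "\<And>u. \<lbrakk>u \<in> K; P u\<rbrakk> \<Longrightarrow> P (- u)"
    and add: "\<And>u v. \<lbrakk>u \<in> K; v \<in> K; P u; P v\<rbrakk> \<Longrightarrow> P (u + v)"
  shows "P u"
  using \<open>u \<in> K\<close> unfolding tensor_kernel_def
proof (induction rule: generate.induct)
  case (inv r)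
  \<comment> \<open>The group inverse of \<open>r\<close> rewrites to \<open>- r\<close> once the
    support of \<open>r\<close> is known to lie in the index set.\<close>
  moreover have "Poly_Mapping.keys r \<subseteq> carrier M \<times> carrier N"
    using inv subsetD [OF tensor_relations_subset, of r] by simp
  ultimately show ?case
    using rel minus [of r] tensor_relations_in_kernel [of r] by simp
qed (auto simp: assms add tensor_kernel_def)

lemma tensor_class_eq_iff:
  assumes "Poly_Mapping.keys u \<subseteq> carrier M \<times> carrier N" "Poly_Mapping.keys v \<subseteq> carrier M \<times> carrier N"
  shows "cls u = cls v \<longleftrightarrow> u - v \<in> K"
proof
  assume "cls u = cls v"
  then have "u \<in> cls v"
    using group.rcos_self [OF group_free_Abelian_group _ subgroup_tensor_kernel, of u] assms
    by (simp add: tensor_class_def)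
  then show "u - v \<in> K"
    by (auto simp: tensor_class_def r_coset_def)
next
  assume "u - v \<in> K"
  then have "u \<in> cls v"
    by (force simp: tensor_class_def r_coset_def)
  then show "cls u = cls v"
    using group.repr_independence [OF group_free_Abelian_group _ _ subgroup_tensor_kernel] assms
    by (fastforce simp: tensor_class_def)
qed

lemma mem_tensor_class_iff: "v \<in> cls u \<longleftrightarrow> v - u \<in> K"
  by (force simp: tensor_class_def r_coset_def)

lemma carrier_tensor_product: "carrier T = cls ` {u. Poly_Mapping.keys u \<subseteq> carrier M \<times> carrier N}"
  by (auto simp: tensor_product_def Let_def carrier_FactGroup tensor_class_def)

lemma tensor_class_closed: "Poly_Mapping.keys u \<subseteq> carrier M \<times> carrier N \<Longrightarrow> cls u \<in> carrier T"
  by (simp add: carrier_tensor_product)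

lemma zero_tensor_product: "\<zero>\<^bsub>T\<^esub> = cls 0"
  by (auto simp: tensor_product_def Let_def tensor_class_def r_coset_def)

lemma tensor_class_zero_iff:
  assumes "Poly_Mapping.keys u \<subseteq> carrier M \<times> carrier N"
  shows "cls u = \<zero>\<^bsub>T\<^esub> \<longleftrightarrow> u \<in> K"
  using tensor_class_eq_iff [of u 0] assms by (simp add: zero_tensor_product)

lemma tensor_class_add:
  assumes "Poly_Mapping.keys u \<subseteq> carrier M \<times> carrier N" "Poly_Mapping.keys v \<subseteq> carrier M \<times> carrier N"
  shows "cls (u + v) = cls u \<oplus>\<^bsub>T\<^esub> cls v"
  using normal.rcos_sum [OF normal_tensor_kernel, of u v] assms
  by (simp add: tensor_product_def Let_def tensor_class_def)

text \<open>The universal property on the level of representatives. The conditions concern classes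
  because in the applications \<open>h\<close> picks representatives, which are biadditive and
  balanced only modulo \<open>K\<close>.\<close>

lemma frag_extend_kernel:
  assumes h: "\<And>x y. \<lbrakk>x \<in> carrier M; y \<in> carrier N\<rbrakk> \<Longrightarrow> Poly_Mapping.keys (h (x, y)) \<subseteq> carrier M \<times> carrier N"
    and add_l: "\<And>x x' y. \<lbrakk>x \<in> carrier M; x' \<in> carrier M; y \<in> carrier N\<rbrakk> \<Longrightarrow>
      cls (h (x \<oplus>\<^bsub>M\<^esub> x', y)) = cls (h (x, y)) \<oplus>\<^bsub>T\<^esub> cls (h (x', y))"
    and add_r: "\<And>x y y'. \<lbrakk>x \<in> carrier M; y \<in> carrier N; y' \<in> carrier N\<rbrakk> \<Longrightarrow>
      cls (h (x, y \<oplus>\<^bsub>N\<^esub> y')) = cls (h (x, y)) \<oplus>\<^bsub>T\<^esub> cls (h (x, y'))"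
    and bal: "\<And>c x y. \<lbrakk>c \<in> carrier R; x \<in> carrier M; y \<in> carrier N\<rbrakk> \<Longrightarrow>
      cls (h (c \<odot>\<^bsub>M\<^esub> x, y)) = cls (h (x, c \<odot>\<^bsub>N\<^esub> y))"
    and "u \<in> K"
  shows "frag_extend h u \<in> K"
proof -
  \<comment> \<open>Both additivity relations are three-term differences, so an equation between
    classes is put into that shape once for both.\<close>
  have sum_rel: "a - b - c \<in> K" if "cls a = cls b \<oplus>\<^bsub>T\<^esub> cls c" "Poly_Mapping.keys a \<subseteq> carrier M \<times> carrier N"
    "Poly_Mapping.keys b \<subseteq> carrier M \<times> carrier N" "Poly_Mapping.keys c \<subseteq> carrier M \<times> carrier N" for a b c
  proof -
    have "Poly_Mapping.keys (b + c) \<subseteq> carrier M \<times> carrier N"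
      using that keys_add [of b c] by blast
    then have "a - (b + c) \<in> K"
      using that by (simp add: tensor_class_add flip: tensor_class_eq_iff)
    then show ?thesis
      by (simp add: algebra_simps)
  qed
  show ?thesis
    using \<open>u \<in> K\<close>
  proof (induction rule: tensor_kernel_induct)
    case (rel r)
    then consider
        (l) x x' y where "r = frag_of (x \<oplus>\<^bsub>M\<^esub> x', y) - frag_of (x, y) - frag_of (x', y)"
          "x \<in> carrier M" "x' \<in> carrier M" "y \<in> carrier N"
      | (r) x y y' where "r = frag_of (x, y \<oplus>\<^bsub>N\<^esub> y') - frag_of (x, y) - frag_of (x, y')"
          "x \<in> carrier M" "y \<in> carrier N" "y' \<in> carrier N"
      | (b) c x y where "r = frag_of (c \<odot>\<^bsub>M\<^esub> x, y) - frag_of (x, c \<odot>\<^bsub>N\<^esub> y)"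
          "c \<in> carrier R" "x \<in> carrier M" "y \<in> carrier N"
      unfolding tensor_relations_def by blast
    then show ?case
    proof cases
      case l
      then show ?thesis
        using sum_rel [OF add_l] by (simp add: frag_extend_diff h)
    next
      case r
      then show ?thesis
        using sum_rel [OF add_r] by (simp add: frag_extend_diff h N_add_closed)
    next
      case b
      then show ?thesis
        using tensor_class_eq_iff [of "h (c \<odot>\<^bsub>M\<^esub> x, y)" "h (x, c \<odot>\<^bsub>N\<^esub> y)"]
        by (simp add: frag_extend_diff h bal N_smult_closed)
    qed
  qed (auto simp: frag_extend_minus frag_extend_add tensor_kernel_zero
      intro: tensor_kernel_uminus tensor_kernel_add)
qed

lemma keys_frag_extend_subset:
  assumes "\<And>p. p \<in> carrier M \<times> carrier N \<Longrightarrow> Poly_Mapping.keys (h p) \<subseteq> S" "Poly_Mapping.keys u \<subseteq> carrier M \<times> carrier N"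
  shows "Poly_Mapping.keys (frag_extend h u) \<subseteq> S"
  using keys_frag_extend [of h u] assms by blast

section \<open>Bilinearity of elementary tensors\<close>

lemma tensor_closed: "\<lbrakk>x \<in> carrier M; y \<in> carrier N\<rbrakk> \<Longrightarrow> tns x y \<in> carrier T"
  by (simp add: tensor_def tensor_class_closed)

lemma tensor_add_left:
  assumes "x \<in> carrier M" "x' \<in> carrier M" "y \<in> carrier N"
  shows "tns (x \<oplus>\<^bsub>M\<^esub> x') y = tns x y \<oplus>\<^bsub>T\<^esub> tns x' y"
proof -
  have "frag_of (x \<oplus>\<^bsub>M\<^esub> x', y) - frag_of (x, y) - frag_of (x', y) \<in> K"
    by (rule tensor_relations_in_kernel) (use assms in \<open>auto simp: tensor_relations_def\<close>)
  then have "frag_of (x \<oplus>\<^bsub>M\<^esub> x', y) - (frag_of (x, y) + frag_of (x', y)) \<in> K"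
    by (simp add: algebra_simps)
  moreover have "Poly_Mapping.keys (frag_of (x, y) + frag_of (x', y)) \<subseteq> carrier M \<times> carrier N"
    using assms keys_add [of "frag_of (x, y)" "frag_of (x', y)"] by auto
  ultimately show ?thesis
    using assms by (simp add: tensor_def flip: tensor_class_eq_iff tensor_class_add)
qed

lemma tensor_add_right:
  assumes "x \<in> carrier M" "y \<in> carrier N" "y' \<in> carrier N"
  shows "tns x (y \<oplus>\<^bsub>N\<^esub> y') = tns x y \<oplus>\<^bsub>T\<^esub> tns x y'"
proof -
  have "frag_of (x, y \<oplus>\<^bsub>N\<^esub> y') - frag_of (x, y) - frag_of (x, y') \<in> K"
    by (rule tensor_relations_in_kernel) (use assms in \<open>auto simp: tensor_relations_def\<close>)
  then have "frag_of (x, y \<oplus>\<^bsub>N\<^esub> y') - (frag_of (x, y) + frag_of (x, y')) \<in> K"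
    by (simp add: algebra_simps)
  moreover have "Poly_Mapping.keys (frag_of (x, y) + frag_of (x, y')) \<subseteq> carrier M \<times> carrier N"
    using assms keys_add [of "frag_of (x, y)" "frag_of (x, y')"] by auto
  ultimately show ?thesis
    using assms by (simp add: tensor_def N_add_closed flip: tensor_class_eq_iff tensor_class_add)
qed

lemma tensor_smult_balanced:
  assumes "c \<in> carrier R" "x \<in> carrier M" "y \<in> carrier N"
  shows "tns (c \<odot>\<^bsub>M\<^esub> x) y = tns x (c \<odot>\<^bsub>N\<^esub> y)"
proof -
  have "frag_of (c \<odot>\<^bsub>M\<^esub> x, y) - frag_of (x, c \<odot>\<^bsub>N\<^esub> y) \<in> K"
    by (rule tensor_relations_in_kernel) (use assms in \<open>auto simp: tensor_relations_def\<close>)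
  then show ?thesis
    using assms by (simp add: tensor_def N_smult_closed flip: tensor_class_eq_iff)
qed

section \<open>The module structure on the quotient\<close>

lemma abelian_group_tensor_product: "abelian_group T"
proof -
  interpret Q: comm_group "F Mod K"
    by (rule comm_group.abelian_FactGroup [OF abelian_free_Abelian_group subgroup_tensor_kernel])
  have ops: "carrier T = carrier (F Mod K)" "x \<oplus>\<^bsub>T\<^esub> y = x \<otimes>\<^bsub>F Mod K\<^esub> y" "\<zero>\<^bsub>T\<^esub> = \<one>\<^bsub>F Mod K\<^esub>" for x y
    by (simp_all add: tensor_product_def Let_def)
  show ?thesis
    by (rule abelian_groupI)
      (auto simp: ops Q.m_assoc simp del: mult_FactGroup one_FactGroup intro!: Q.m_comm Q.l_inv_ex)
qed

text \<open>The map on representatives hidden in the scalar multiplication of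
  \<open>tensor_product\<close>, named so that its compatibility with cosets can be proved.\<close>

definition scale :: "'a \<Rightarrow> ('c \<times> 'e \<Rightarrow>\<^sub>0 int) \<Rightarrow> ('c \<times> 'e \<Rightarrow>\<^sub>0 int)"
  where "scale c = frag_extend (\<lambda>(x, y). frag_of (c \<odot>\<^bsub>M\<^esub> x, y))"

lemma scale_frag_of: "scale c (frag_of (x, y)) = frag_of (c \<odot>\<^bsub>M\<^esub> x, y)"
  by (simp add: scale_def)

text \<open>The balancing relation survives because scalars commute: \<open>d\<close> is moved past
  \<open>c\<close> and then crosses the tensor sign.\<close>

lemma scale_kernel:
  assumes "c \<in> carrier R" "u \<in> K"
  shows "scale c u \<in> K"
  unfolding scale_def
proof (rule frag_extend_kernel)
  fix d x y assume "d \<in> carrier R" "x \<in> carrier M" "y \<in> carrier N"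
  then show "cls (case (d \<odot>\<^bsub>M\<^esub> x, y) of (x, y) \<Rightarrow> frag_of (c \<odot>\<^bsub>M\<^esub> x, y)) =
      cls (case (x, d \<odot>\<^bsub>N\<^esub> y) of (x, y) \<Rightarrow> frag_of (c \<odot>\<^bsub>M\<^esub> x, y))"
    using tensor_smult_balanced [of d "c \<odot>\<^bsub>M\<^esub> x" y] assms
    by (simp add: R.m_comm flip: smult_assoc1 tensor_def)
qed (use assms in \<open>auto simp: smult_r_distr tensor_add_left tensor_add_right simp flip: tensor_def\<close>)

lemma keys_scale:
  "\<lbrakk>c \<in> carrier R; Poly_Mapping.keys u \<subseteq> carrier M \<times> carrier N\<rbrakk> \<Longrightarrow> Poly_Mapping.keys (scale c u) \<subseteq> carrier M \<times> carrier N"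
  unfolding scale_def by (rule keys_frag_extend_subset) auto

text \<open>The union defining the scalar action collapses: two representatives differ by an element
  of \<open>K\<close>, which \<open>scale c\<close> maps into \<open>K\<close>, so all classes in
  the union coincide; the union is nonempty since \<open>u\<close> lies in its own class.\<close>

lemma smult_tensor_class:
  assumes "c \<in> carrier R" "Poly_Mapping.keys u \<subseteq> carrier M \<times> carrier N"
  shows "c \<odot>\<^bsub>T\<^esub> cls u = cls (scale c u)"
proof -
  have "cls (scale c v) = cls (scale c u)" if "v \<in> cls u" for v
  proof -
    have diff: "v - u \<in> K"
      using that by (simp add: mem_tensor_class_iff)
    then have "Poly_Mapping.keys v \<subseteq> carrier M \<times> carrier N"
      using assms(2) tensor_kernel_keys [OF diff] keys_add [of "v - u" u] by auto
    then show ?thesis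
      using assms scale_kernel [OF _ diff]
      by (simp add: tensor_class_eq_iff keys_scale) (simp add: scale_def frag_extend_diff)
  qed
  moreover have "u \<in> cls u"
    by (simp add: mem_tensor_class_iff tensor_kernel_zero)
  moreover have "c \<odot>\<^bsub>T\<^esub> cls u = (\<Union>v\<in>cls u. cls (scale c v))"
    by (simp add: tensor_product_def Let_def scale_def)
  ultimately show ?thesis
    by blast
qed

lemma smult_tensor:
  assumes "c \<in> carrier R" "x \<in> carrier M" "y \<in> carrier N"
  shows "c \<odot>\<^bsub>T\<^esub> tns x y = tns (c \<odot>\<^bsub>M\<^esub> x) y"
  using assms smult_tensor_class [of c "frag_of (x, y)"] by (simp add: tensor_def scale_frag_of)

lemma smult_tensor_product_closed:
  "\<lbrakk>c \<in> carrier R; U \<in> carrier T\<rbrakk> \<Longrightarrow> c \<odot>\<^bsub>T\<^esub> U \<in> carrier T"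
  by (auto simp: carrier_tensor_product smult_tensor_class keys_scale)

lemma smult_tensor_product_add:
  assumes "c \<in> carrier R" "U \<in> carrier T" "V \<in> carrier T"
  shows "c \<odot>\<^bsub>T\<^esub> (U \<oplus>\<^bsub>T\<^esub> V) = c \<odot>\<^bsub>T\<^esub> U \<oplus>\<^bsub>T\<^esub> c \<odot>\<^bsub>T\<^esub> V"
proof -
  obtain u v where uv: "Poly_Mapping.keys u \<subseteq> carrier M \<times> carrier N" "Poly_Mapping.keys v \<subseteq> carrier M \<times> carrier N"
    "U = cls u" "V = cls v"
    using assms by (auto simp: carrier_tensor_product)
  moreover have "Poly_Mapping.keys (u + v) \<subseteq> carrier M \<times> carrier N"
    using uv keys_add [of u v] by blast
  moreover have "scale c (u + v) = scale c u + scale c v"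
    by (simp add: scale_def frag_extend_add)
  ultimately show ?thesis
    using assms(1) by (simp add: smult_tensor_class keys_scale flip: tensor_class_add)
qed

sublocale T: abelian_group T
  by (rule abelian_group_tensor_product)

lemma tensor_zero_left: "y \<in> carrier N \<Longrightarrow> tns \<zero>\<^bsub>M\<^esub> y = \<zero>\<^bsub>T\<^esub>"
  using tensor_add_left [of "\<zero>\<^bsub>M\<^esub>" "\<zero>\<^bsub>M\<^esub>" y] tensor_closed [of "\<zero>\<^bsub>M\<^esub>" y]
  by (simp add: T.add.r_cancel_one')

lemma tensor_minus_left:
  assumes "x \<in> carrier M" "y \<in> carrier N"
  shows "tns (\<ominus>\<^bsub>M\<^esub> x) y = \<ominus>\<^bsub>T\<^esub> tns x y"
proof (rule sym, rule T.minus_equality)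
  show "tns (\<ominus>\<^bsub>M\<^esub> x) y \<oplus>\<^bsub>T\<^esub> tns x y = \<zero>\<^bsub>T\<^esub>"
    using assms by (simp add: M.l_neg tensor_zero_left flip: tensor_add_left)
qed (use assms in \<open>auto intro: tensor_closed\<close>)

lemma tensor_class_uminus:
  assumes "Poly_Mapping.keys u \<subseteq> carrier M \<times> carrier N"
  shows "cls (- u) = \<ominus>\<^bsub>T\<^esub> cls u"
proof (rule sym, rule T.minus_equality)
  show "cls (- u) \<oplus>\<^bsub>T\<^esub> cls u = \<zero>\<^bsub>T\<^esub>"
    using assms tensor_class_add [of "- u" u] by (simp add: zero_tensor_product)
qed (use assms in \<open>auto intro!: tensor_class_closed\<close>)

lemma tensor_class_diff:
  assumes "Poly_Mapping.keys u \<subseteq> carrier M \<times> carrier N" "Poly_Mapping.keys v \<subseteq> carrier M \<times> carrier N"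
  shows "cls (u - v) = cls u \<ominus>\<^bsub>T\<^esub> cls v"
  using tensor_class_add [of u "- v"] assms by (simp add: tensor_class_uminus a_minus_def)

text \<open>No case for negation arises, because the negative of an elementary tensor is again
  elementary: the sign goes into the left entry.\<close>

lemma tensor_product_induct [consumes 1, case_names tensor add]:
  assumes "U \<in> carrier T"
    and tensor: "\<And>x y. \<lbrakk>x \<in> carrier M; y \<in> carrier N\<rbrakk> \<Longrightarrow> P (tns x y)"
    and add: "\<And>U V. \<lbrakk>U \<in> carrier T; V \<in> carrier T; P U; P V\<rbrakk> \<Longrightarrow> P (U \<oplus>\<^bsub>T\<^esub> V)"
  shows "P U"
proof -
  obtain u where u: "Poly_Mapping.keys u \<subseteq> carrier M \<times> carrier N" "U = cls u"
    using assms(1) by (auto simp: carrier_tensor_product)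
  \<comment> \<open>The free group is built from generators by differences, so the claim is carried
    for a class and its negative simultaneously.\<close>
  have "P (cls u) \<and> P (\<ominus>\<^bsub>T\<^esub> cls u)"
    using u(1)
  proof (induction u rule: free_Abelian_group_induct [consumes 1, case_names zero diff frag_of])
    case zero
    obtain y where "y \<in> carrier N"
      using N_nonempty by blast
    then have "P (tns \<zero>\<^bsub>M\<^esub> y)"
      by (intro tensor) auto
    with \<open>y \<in> carrier N\<close> show ?case
      using tensor_class_uminus [of 0] by (simp add: tensor_zero_left zero_tensor_product)
  next
    case (diff u v)
    have cl: "cls u \<in> carrier T" "cls v \<in> carrier T"
      using diff by (auto intro: tensor_class_closed)
    have "P (cls u \<oplus>\<^bsub>T\<^esub> \<ominus>\<^bsub>T\<^esub> cls v)" "P (cls v \<oplus>\<^bsub>T\<^esub> \<ominus>\<^bsub>T\<^esub> cls u)"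
      using diff cl by (auto intro: add)
    moreover have "\<ominus>\<^bsub>T\<^esub> cls (u - v) = cls v \<oplus>\<^bsub>T\<^esub> \<ominus>\<^bsub>T\<^esub> cls u"
      using diff cl by (simp add: tensor_class_diff a_minus_def T.minus_add T.a_comm)
    ultimately show ?case
      using diff by (simp add: tensor_class_diff a_minus_def)
  next
    case (frag_of p)
    then obtain x y where p: "p = (x, y)" "x \<in> carrier M" "y \<in> carrier N"
      by auto
    then show ?case
      using tensor [of x y] tensor [of "\<ominus>\<^bsub>M\<^esub> x" y] by (simp add: tensor_minus_left flip: tensor_def)
  qed
  then show ?thesis
    using u by simp
qed

lemma module_tensor_product: "module R T"
proof (rule moduleI)
  fix a b U assume ab: "a \<in> carrier R" "b \<in> carrier R" and U: "U \<in> carrier T"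
  show "(a \<oplus> b) \<odot>\<^bsub>T\<^esub> U = a \<odot>\<^bsub>T\<^esub> U \<oplus>\<^bsub>T\<^esub> b \<odot>\<^bsub>T\<^esub> U"
    using U
  proof (induction rule: tensor_product_induct)
    case (add U V)
    then show ?case
      using ab by (simp add: smult_tensor_product_add smult_tensor_product_closed T.a_ac)
  qed (use ab in \<open>simp add: smult_tensor smult_l_distr tensor_add_left\<close>)
  show "(a \<otimes> b) \<odot>\<^bsub>T\<^esub> U = a \<odot>\<^bsub>T\<^esub> (b \<odot>\<^bsub>T\<^esub> U)"
    using U by (induction rule: tensor_product_induct)
      (use ab in \<open>simp_all add: smult_tensor smult_assoc1 smult_tensor_product_add smult_tensor_product_closed\<close>)
next
  fix U assume "U \<in> carrier T"
  then show "\<one> \<odot>\<^bsub>T\<^esub> U = U"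
    by (induction rule: tensor_product_induct) (simp_all add: smult_tensor smult_tensor_product_add)
qed (simp_all add: smult_tensor_product_add smult_tensor_product_closed R.is_cring abelian_group_tensor_product)

end

section \<open>Extending operations from elementary tensors\<close>

lemma frag_extend_diff_fun:
  "frag_extend (\<lambda>p. f p - g p) u = frag_extend f u - frag_extend g u"
  by (induction u rule: frag_induction [OF subset_UNIV]) (auto simp: frag_extend_diff)

definition frag_extend2 :: "('a \<Rightarrow> 'b \<Rightarrow> ('c \<Rightarrow>\<^sub>0 int)) \<Rightarrow> ('a \<Rightarrow>\<^sub>0 int) \<Rightarrow> ('b \<Rightarrow>\<^sub>0 int) \<Rightarrow> ('c \<Rightarrow>\<^sub>0 int)"
  where "frag_extend2 h u v = frag_extend (\<lambda>p. frag_extend (h p) v) u"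

text \<open>Interchange of two finite sums. It gives additivity in the second argument by the same
  argument as in the first.\<close>

lemma frag_extend2_swap:
  "frag_extend2 h u v = frag_extend (\<lambda>q. frag_extend (\<lambda>p. h p q) u) v"
  unfolding frag_extend2_def
  by (induction v rule: frag_induction [OF subset_UNIV])
    (auto simp: frag_extend_diff frag_extend_diff_fun frag_extend_eq_0)

lemma frag_extend2_frag_of [simp]: "frag_extend2 h (frag_of p) (frag_of q) = h p q"
  by (simp add: frag_extend2_def)

lemma frag_extend2_zero [simp]: "frag_extend2 h 0 v = 0" "frag_extend2 h u 0 = 0"
  by (simp add: frag_extend2_def, simp add: frag_extend2_swap)

lemma frag_extend2_diff_left: "frag_extend2 h (u - u') v = frag_extend2 h u v - frag_extend2 h u' v"
  by (simp add: frag_extend2_def frag_extend_diff)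

lemma frag_extend2_diff_right: "frag_extend2 h u (v - v') = frag_extend2 h u v - frag_extend2 h u v'"
  by (simp add: frag_extend2_swap frag_extend_diff)

lemma frag_extend2_add_left: "frag_extend2 h (u + u') v = frag_extend2 h u v + frag_extend2 h u' v"
  by (simp add: frag_extend2_def frag_extend_add)

lemma frag_extend2_add_right: "frag_extend2 h u (v + v') = frag_extend2 h u v + frag_extend2 h u v'"
  by (simp add: frag_extend2_swap frag_extend_add)

lemma keys_frag_extend2:
  assumes "\<And>p q. \<lbrakk>p \<in> S; q \<in> S'\<rbrakk> \<Longrightarrow> Poly_Mapping.keys (h p q) \<subseteq> S''"
    and "Poly_Mapping.keys u \<subseteq> S" "Poly_Mapping.keys v \<subseteq> S'"
  shows "Poly_Mapping.keys (frag_extend2 h u v) \<subseteq> S''"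
proof -
  have "Poly_Mapping.keys (frag_extend (h p) v) \<subseteq> S''" if "p \<in> S" for p
    using keys_frag_extend [of "h p" v] assms(1) [OF that] assms(3) by blast
  then show ?thesis
    using keys_frag_extend [of "\<lambda>p. frag_extend (h p) v" u] assms(2) unfolding frag_extend2_def by blast
qed

lemma bilinear_opD:
  assumes "bilinear_op R L m"
  shows "\<lbrakk>x \<in> carrier L; y \<in> carrier L\<rbrakk> \<Longrightarrow> m x y \<in> carrier L"
    and "\<lbrakk>x \<in> carrier L; y \<in> carrier L; z \<in> carrier L\<rbrakk> \<Longrightarrow> m (x \<oplus>\<^bsub>L\<^esub> y) z = m x z \<oplus>\<^bsub>L\<^esub> m y z"
    and "\<lbrakk>x \<in> carrier L; y \<in> carrier L; z \<in> carrier L\<rbrakk> \<Longrightarrow> m x (y \<oplus>\<^bsub>L\<^esub> z) = m x y \<oplus>\<^bsub>L\<^esub> m x z"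
    and "\<lbrakk>c \<in> carrier R; x \<in> carrier L; y \<in> carrier L\<rbrakk> \<Longrightarrow> m (c \<odot>\<^bsub>L\<^esub> x) y = c \<odot>\<^bsub>L\<^esub> m x y"
    and "\<lbrakk>c \<in> carrier R; x \<in> carrier L; y \<in> carrier L\<rbrakk> \<Longrightarrow> m x (c \<odot>\<^bsub>L\<^esub> y) = c \<odot>\<^bsub>L\<^esub> m x y"
  using assms by (simp_all add: bilinear_op_def)

lemma (in module) bilinear_op_zero:
  assumes "bilinear_op R M m" "x \<in> carrier M"
  shows "m \<zero>\<^bsub>M\<^esub> x = \<zero>\<^bsub>M\<^esub>" "m x \<zero>\<^bsub>M\<^esub> = \<zero>\<^bsub>M\<^esub>"
  using bilinear_opD(4) [OF assms(1), of \<zero> "\<zero>\<^bsub>M\<^esub>" x] bilinear_opD(5) [OF assms(1), of \<zero> x "\<zero>\<^bsub>M\<^esub>"]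
    bilinear_opD(1) [OF assms(1)] assms(2)
  by simp_all

text \<open>The simplification rules erase signs and, combined with associativity and commutativity,
  cancel repeated summands. Identities in characteristic 2 thereby reduce to a parity count of
  terms.\<close>

locale char2_abelian_group = abelian_group +
  assumes double [simp]: "x \<in> carrier G \<Longrightarrow> x \<oplus> x = \<zero>"
begin

lemma double_left [simp]: "\<lbrakk>x \<in> carrier G; y \<in> carrier G\<rbrakk> \<Longrightarrow> x \<oplus> (x \<oplus> y) = y"
  by (simp flip: a_assoc)

lemma minus_self [simp]: "x \<in> carrier G \<Longrightarrow> \<ominus> x = x"
  by (rule minus_equality) simp_all

lemma diff_eq_add [simp]: "\<lbrakk>x \<in> carrier G; y \<in> carrier G\<rbrakk> \<Longrightarrow> x \<ominus> y = x \<oplus> y"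
  by (simp add: a_minus_def)

end

lemma (in module) char2_abelian_group:
  assumes "\<one> \<oplus> \<one> = \<zero>"
  shows "char2_abelian_group M"
proof
  fix x assume "x \<in> carrier M"
  then show "x \<oplus>\<^bsub>M\<^esub> x = \<zero>\<^bsub>M\<^esub>"
    using smult_l_distr [of \<one> \<one> x] assms by simp
qed

section \<open>Descent of bilinear and quadratic maps to the tensor product\<close>

context tensor_modules
begin

sublocale T: module R T
  by (rule module_tensor_product)

definition bilinear_map :: "('c \<Rightarrow> 'e \<Rightarrow> ('c \<times> 'e \<Rightarrow>\<^sub>0 int) set) \<Rightarrow> bool"
  where "bilinear_map C \<longleftrightarrow>
    (\<forall>x\<in>carrier M. \<forall>y\<in>carrier N. C x y \<in> carrier T) \<and>
    (\<forall>x\<in>carrier M. \<forall>x'\<in>carrier M. \<forall>y\<in>carrier N. C (x \<oplus>\<^bsub>M\<^esub> x') y = C x y \<oplus>\<^bsub>T\<^esub> C x' y) \<and>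
    (\<forall>x\<in>carrier M. \<forall>y\<in>carrier N. \<forall>y'\<in>carrier N. C x (y \<oplus>\<^bsub>N\<^esub> y') = C x y \<oplus>\<^bsub>T\<^esub> C x y') \<and>
    (\<forall>c\<in>carrier R. \<forall>x\<in>carrier M. \<forall>y\<in>carrier N. C (c \<odot>\<^bsub>M\<^esub> x) y = c \<odot>\<^bsub>T\<^esub> C x y) \<and>
    (\<forall>c\<in>carrier R. \<forall>x\<in>carrier M. \<forall>y\<in>carrier N. C x (c \<odot>\<^bsub>N\<^esub> y) = c \<odot>\<^bsub>T\<^esub> C x y)"

definition rep :: "('c \<times> 'e \<Rightarrow>\<^sub>0 int) set \<Rightarrow> ('c \<times> 'e \<Rightarrow>\<^sub>0 int)"
  where "rep U = (SOME u. Poly_Mapping.keys u \<subseteq> carrier M \<times> carrier N \<and> cls u = U)"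

lemma rep: "U \<in> carrier T \<Longrightarrow> Poly_Mapping.keys (rep U) \<subseteq> carrier M \<times> carrier N"
  "U \<in> carrier T \<Longrightarrow> cls (rep U) = U"
  using someI_ex [of "\<lambda>u. Poly_Mapping.keys u \<subseteq> carrier M \<times> carrier N \<and> cls u = U"]
  by (auto simp: carrier_tensor_product rep_def)

lemma rep_tensor_class_diff:
  assumes "Poly_Mapping.keys u \<subseteq> carrier M \<times> carrier N"
  shows "rep (cls u) - u \<in> K"
  using assms tensor_class_eq_iff [of "rep (cls u)" u] rep [of "cls u"] tensor_class_closed [of u] by simp

text \<open>Representatives of the values of \<open>B\<close> are extended biadditively to the free
  group. Bilinearity in either pair of variables makes this extension send \<open>K\<close> in
  either slot into \<open>K\<close>, so it descends to classes.\<close>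

lemma ex_bilinear_op:
  assumes left: "\<And>x' y'. \<lbrakk>x' \<in> carrier M; y' \<in> carrier N\<rbrakk> \<Longrightarrow> bilinear_map (\<lambda>x y. B x y x' y')"
    and right: "\<And>x y. \<lbrakk>x \<in> carrier M; y \<in> carrier N\<rbrakk> \<Longrightarrow> bilinear_map (B x y)"
  shows "\<exists>m. bilinear_op R T m \<and>
    (\<forall>x\<in>carrier M. \<forall>y\<in>carrier N. \<forall>x'\<in>carrier M. \<forall>y'\<in>carrier N. m (tns x y) (tns x' y') = B x y x' y')"
proof -
  define h where "h = (\<lambda>(x, y) (x', y'). rep (B x y x' y'))"
  define e where "e = frag_extend2 h"
  have B_closed: "B x y x' y' \<in> carrier T"
    if "x \<in> carrier M" "y \<in> carrier N" "x' \<in> carrier M" "y' \<in> carrier N" for x y x' y'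
    using right that by (simp add: bilinear_map_def)
  have h: "Poly_Mapping.keys (h (x, y) (x', y')) \<subseteq> carrier M \<times> carrier N" "cls (h (x, y) (x', y')) = B x y x' y'"
    if "x \<in> carrier M" "y \<in> carrier N" "x' \<in> carrier M" "y' \<in> carrier N" for x y x' y'
    using rep [OF B_closed [OF that]] by (simp_all add: h_def)
  have h_keys: "Poly_Mapping.keys (h p q) \<subseteq> carrier M \<times> carrier N"
    if "p \<in> carrier M \<times> carrier N" "q \<in> carrier M \<times> carrier N" for p q
    using that by (cases p; cases q) (simp add: h)
  have e_keys: "Poly_Mapping.keys (e u v) \<subseteq> carrier M \<times> carrier N"
    if "Poly_Mapping.keys u \<subseteq> carrier M \<times> carrier N" "Poly_Mapping.keys v \<subseteq> carrier M \<times> carrier N" for u v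
    unfolding e_def using h_keys that by (rule keys_frag_extend2)
  \<comment> \<open>Descent is first shown with a single generator in the other slot, where
    \<open>frag_extend_kernel\<close> applies, and then extended additively in that slot.\<close>
  have base_right: "frag_extend (h p) v \<in> K" if "p \<in> carrier M \<times> carrier N" "v \<in> K" for p v
  proof -
    obtain x y where p: "p = (x, y)" "x \<in> carrier M" "y \<in> carrier N"
      using \<open>p \<in> _\<close> by auto
    show ?thesis
      using right [OF p(2,3)] \<open>v \<in> K\<close> unfolding p(1)
      by (intro frag_extend_kernel) (auto simp: p h bilinear_map_def N_add_closed N_smult_closed)
  qed
  have base_left: "frag_extend (\<lambda>p. h p q) u \<in> K" if "q \<in> carrier M \<times> carrier N" "u \<in> K" for q u
  proof -
    obtain x y where q: "q = (x, y)" "x \<in> carrier M" "y \<in> carrier N"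
      using \<open>q \<in> _\<close> by auto
    show ?thesis
      using left [OF q(2,3)] \<open>u \<in> K\<close> unfolding q(1)
      by (intro frag_extend_kernel) (auto simp: q h bilinear_map_def N_add_closed N_smult_closed)
  qed
  have e_right: "e u v \<in> K" if "Poly_Mapping.keys u \<subseteq> carrier M \<times> carrier N" "v \<in> K" for u v
    using that(1) unfolding e_def frag_extend2_def
    by (induction u rule: frag_induction)
      (use \<open>v \<in> K\<close> in \<open>auto simp: base_right frag_extend_diff tensor_kernel_zero intro: tensor_kernel_diff\<close>)
  have e_left: "e u v \<in> K" if "Poly_Mapping.keys v \<subseteq> carrier M \<times> carrier N" "u \<in> K" for u v
    using that(1) unfolding e_def frag_extend2_swap
    by (induction v rule: frag_induction)
      (use \<open>u \<in> K\<close> in \<open>auto simp: base_left frag_extend_diff tensor_kernel_zero intro: tensor_kernel_diff\<close>)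
  define m where "m = (\<lambda>U V. cls (e (rep U) (rep V)))"
  have m_cls: "m (cls u) (cls v) = cls (e u v)"
    if u: "Poly_Mapping.keys u \<subseteq> carrier M \<times> carrier N" and v: "Poly_Mapping.keys v \<subseteq> carrier M \<times> carrier N" for u v
  proof -
    have ru: "Poly_Mapping.keys (rep (cls u)) \<subseteq> carrier M \<times> carrier N"
      and rv: "Poly_Mapping.keys (rep (cls v)) \<subseteq> carrier M \<times> carrier N"
      using u v by (simp_all add: rep tensor_class_closed)
    \<comment> \<open>The chosen representatives are exchanged one slot at a time, so each summand
      has an element of \<open>K\<close> in one argument.\<close>
    have "e (rep (cls u)) (rep (cls v)) - e u v = e (rep (cls u)) (rep (cls v) - v) + e (rep (cls u) - u) v"
      by (simp add: e_def frag_extend2_diff_left frag_extend2_diff_right)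
    also have "\<dots> \<in> K"
      using u v ru by (intro tensor_kernel_add e_right e_left rep_tensor_class_diff)
    finally show ?thesis
      using u v ru rv by (simp add: m_def tensor_class_eq_iff e_keys)
  qed
  have m_tns: "m (tns x y) (tns x' y') = B x y x' y'"
    if "x \<in> carrier M" "y \<in> carrier N" "x' \<in> carrier M" "y' \<in> carrier N" for x y x' y'
    using that m_cls [of "frag_of (x, y)" "frag_of (x', y')"] by (simp add: tensor_def e_def h)
  have m_closed: "m U V \<in> carrier T" if "U \<in> carrier T" "V \<in> carrier T" for U V
    using that by (simp add: m_def tensor_class_closed e_keys rep)
  have m_add_left: "m (U \<oplus>\<^bsub>T\<^esub> U') V = m U V \<oplus>\<^bsub>T\<^esub> m U' V"
    if UV: "U \<in> carrier T" "U' \<in> carrier T" "V \<in> carrier T" for U U' V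
  proof -
    obtain u u' v where *: "U = cls u" "U' = cls u'" "V = cls v"
      "Poly_Mapping.keys u \<subseteq> carrier M \<times> carrier N" "Poly_Mapping.keys u' \<subseteq> carrier M \<times> carrier N"
      "Poly_Mapping.keys v \<subseteq> carrier M \<times> carrier N"
      using UV by (auto simp: carrier_tensor_product)
    moreover have "Poly_Mapping.keys (u + u') \<subseteq> carrier M \<times> carrier N"
      using * keys_add [of u u'] by blast
    moreover have "e (u + u') v = e u v + e u' v"
      by (simp add: e_def frag_extend2_add_left)
    ultimately show ?thesis
      by (simp add: m_cls e_keys flip: tensor_class_add)
  qed
  have m_add_right: "m V (U \<oplus>\<^bsub>T\<^esub> U') = m V U \<oplus>\<^bsub>T\<^esub> m V U'"
    if UV: "U \<in> carrier T" "U' \<in> carrier T" "V \<in> carrier T" for U U' V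
  proof -
    obtain u u' v where *: "U = cls u" "U' = cls u'" "V = cls v"
      "Poly_Mapping.keys u \<subseteq> carrier M \<times> carrier N" "Poly_Mapping.keys u' \<subseteq> carrier M \<times> carrier N"
      "Poly_Mapping.keys v \<subseteq> carrier M \<times> carrier N"
      using UV by (auto simp: carrier_tensor_product)
    moreover have "Poly_Mapping.keys (u + u') \<subseteq> carrier M \<times> carrier N"
      using * keys_add [of u u'] by blast
    moreover have "e v (u + u') = e v u + e v u'"
      by (simp add: e_def frag_extend2_add_right)
    ultimately show ?thesis
      by (simp add: m_cls e_keys flip: tensor_class_add)
  qed
  have m_smult_left: "m (c \<odot>\<^bsub>T\<^esub> U) V = c \<odot>\<^bsub>T\<^esub> m U V"
    if "c \<in> carrier R" and U: "U \<in> carrier T" and V: "V \<in> carrier T" for c U V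
    using U
  proof (induction rule: tensor_product_induct)
    case (tensor x y)
    show ?case
      using V
      by (induction rule: tensor_product_induct)
        (use that tensor left in \<open>simp_all add: smult_tensor m_tns m_add_right m_closed tensor_closed
          T.smult_r_distr bilinear_map_def\<close>)
  qed (use that in \<open>simp add: T.smult_r_distr m_add_left m_closed\<close>)
  have m_smult_right: "m V (c \<odot>\<^bsub>T\<^esub> U) = c \<odot>\<^bsub>T\<^esub> m V U"
    if "c \<in> carrier R" and U: "U \<in> carrier T" and V: "V \<in> carrier T" for c U V
    using U
  proof (induction rule: tensor_product_induct)
    case (tensor x y)
    show ?case
      using V
      by (induction rule: tensor_product_induct)
        (use that tensor right in \<open>simp_all add: smult_tensor m_tns m_add_left m_closed tensor_closed
          T.smult_r_distr bilinear_map_def\<close>)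
  qed (use that in \<open>simp add: T.smult_r_distr m_add_right m_closed\<close>)
  show ?thesis
    by (intro exI [of _ m]) (simp add: bilinear_op_def m_tns m_closed m_add_left m_add_right m_smult_left m_smult_right)
qed

text \<open>The compatibility conditions on \<open>Q\<close> express that the quadratic form
  vanishes on the three kinds of tensor relation; the remaining cross terms cancel by
  \<open>sym\<close>, \<open>alt\<close> and \<open>char2\<close>.\<close>

lemma ex_quadratic_map:
  assumes char2: "\<one> \<oplus> \<one> = \<zero>"
    and m: "bilinear_op R T m"
    and sym: "\<And>U V. \<lbrakk>U \<in> carrier T; V \<in> carrier T\<rbrakk> \<Longrightarrow> m U V = m V U"
    and alt: "\<And>x y. \<lbrakk>x \<in> carrier M; y \<in> carrier N\<rbrakk> \<Longrightarrow> m (tns x y) (tns x y) = \<zero>\<^bsub>T\<^esub>"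
    and Q: "\<And>x y. \<lbrakk>x \<in> carrier M; y \<in> carrier N\<rbrakk> \<Longrightarrow> Q x y \<in> carrier T"
    and Q_add_left: "\<And>x x' y. \<lbrakk>x \<in> carrier M; x' \<in> carrier M; y \<in> carrier N\<rbrakk> \<Longrightarrow>
      Q (x \<oplus>\<^bsub>M\<^esub> x') y = Q x y \<oplus>\<^bsub>T\<^esub> Q x' y \<oplus>\<^bsub>T\<^esub> m (tns x y) (tns x' y)"
    and Q_add_right: "\<And>x y y'. \<lbrakk>x \<in> carrier M; y \<in> carrier N; y' \<in> carrier N\<rbrakk> \<Longrightarrow>
      Q x (y \<oplus>\<^bsub>N\<^esub> y') = Q x y \<oplus>\<^bsub>T\<^esub> Q x y' \<oplus>\<^bsub>T\<^esub> m (tns x y) (tns x y')"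
    and Q_smult: "\<And>c x y. \<lbrakk>c \<in> carrier R; x \<in> carrier M; y \<in> carrier N\<rbrakk> \<Longrightarrow>
      Q (c \<odot>\<^bsub>M\<^esub> x) y = Q x (c \<odot>\<^bsub>N\<^esub> y)"
  shows "\<exists>s. (\<forall>U\<in>carrier T. s U \<in> carrier T) \<and>
    (\<forall>x\<in>carrier M. \<forall>y\<in>carrier N. s (tns x y) = Q x y) \<and>
    (\<forall>U\<in>carrier T. \<forall>V\<in>carrier T. s (U \<oplus>\<^bsub>T\<^esub> V) = s U \<oplus>\<^bsub>T\<^esub> s V \<oplus>\<^bsub>T\<^esub> m U V)"
proof -
  interpret T: char2_abelian_group T
    by (rule T.char2_abelian_group [OF char2])
  note m_simps = bilinear_opD(1-3) [OF m] T.bilinear_op_zero [OF m]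
  \<comment> \<open>The well-order is used as a linear order: for two distinct generators exactly
    one of the two ordered pairs lies in \<open>r\<close>.\<close>
  obtain r :: "(('c \<times> 'e) \<times> ('c \<times> 'e)) set" where r: "Well_order r" "Field r = UNIV"
    using well_ordering [where 'a = "'c \<times> 'e"] by metis
  then have r_total: "(p, q) \<in> r \<or> (q, p) \<in> r" and r_antisym: "\<lbrakk>(p, q) \<in> r; (q, p) \<in> r\<rbrakk> \<Longrightarrow> p = q"
    if "p \<noteq> q" for p q
    using that unfolding well_order_on_def linear_order_on_def partial_order_on_def
      total_on_def antisym_def by blast+
  \<comment> \<open>Order the basis: the bilinear form \<open>e\<close> has \<open>Q\<close> on the diagonal, \<open>m\<close> above it and \<open>0\<close> below.
    Hence \<open>q u = e u u\<close> has polarisation \<open>e u v + e v u\<close>, which is \<open>m\<close> modulo the tensor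
    relations since \<open>m\<close> is symmetric and \<open>2 = 0\<close>.\<close>
  define h where "h = (\<lambda>p q. rep (if p = q then case p of (x, y) \<Rightarrow> Q x y
    else if (p, q) \<in> r then m (cls (frag_of p)) (cls (frag_of q)) else \<zero>\<^bsub>T\<^esub>))"
  define e where "e = frag_extend2 h"
  have h: "Poly_Mapping.keys (h p q) \<subseteq> carrier M \<times> carrier N"
    "cls (h p q) = (if p = q then case p of (x, y) \<Rightarrow> Q x y
      else if (p, q) \<in> r then m (cls (frag_of p)) (cls (frag_of q)) else \<zero>\<^bsub>T\<^esub>)"
    if "p \<in> carrier M \<times> carrier N" "q \<in> carrier M \<times> carrier N" for p q
    using that unfolding h_def by (auto intro!: rep Q m_simps tensor_class_closed)
  have e_keys: "Poly_Mapping.keys (e u v) \<subseteq> carrier M \<times> carrier N"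
    if "Poly_Mapping.keys u \<subseteq> carrier M \<times> carrier N" "Poly_Mapping.keys v \<subseteq> carrier M \<times> carrier N" for u v
    unfolding e_def using h(1) that by (rule keys_frag_extend2)
  have e_diff: "e (u - u') v = e u v - e u' v" "e u (v - v') = e u v - e u v'" for u u' v v'
    by (simp_all add: e_def frag_extend2_diff_left frag_extend2_diff_right)
  have cls_add: "cls (u + v) = cls u \<oplus>\<^bsub>T\<^esub> cls v" and cls_diff: "cls (u - v) = cls u \<oplus>\<^bsub>T\<^esub> cls v"
    if "Poly_Mapping.keys u \<subseteq> carrier M \<times> carrier N" "Poly_Mapping.keys v \<subseteq> carrier M \<times> carrier N" for u v
    using that by (simp_all add: tensor_class_add tensor_class_diff tensor_class_closed)
  have polar: "cls (e u v) \<oplus>\<^bsub>T\<^esub> cls (e v u) = m (cls u) (cls v)"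
    if u: "Poly_Mapping.keys u \<subseteq> carrier M \<times> carrier N" and v: "Poly_Mapping.keys v \<subseteq> carrier M \<times> carrier N" for u v
    using u
  proof (induction u rule: free_Abelian_group_induct [consumes 1, case_names zero diff frag_of])
    case zero
    then show ?case
      using v by (simp add: e_def m_simps tensor_class_closed flip: zero_tensor_product)
  next
    case (diff u u')
    from diff.hyps have "cls (e (u - u') v) \<oplus>\<^bsub>T\<^esub> cls (e v (u - u')) =
        (cls (e u v) \<oplus>\<^bsub>T\<^esub> cls (e v u)) \<oplus>\<^bsub>T\<^esub> (cls (e u' v) \<oplus>\<^bsub>T\<^esub> cls (e v u'))"
      using v by (simp add: e_diff cls_diff e_keys tensor_class_closed T.a_ac)
    also have "\<dots> = m (cls u) (cls v) \<oplus>\<^bsub>T\<^esub> m (cls u') (cls v)"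
      by (simp only: diff.IH)
    finally show ?case
      using diff.hyps v by (simp add: cls_diff m_simps tensor_class_closed)
  next
    case (frag_of p)
    show ?case
      using v
    proof (induction v rule: free_Abelian_group_induct [consumes 1, case_names zero diff frag_of])
      case zero
      then show ?case
        using frag_of by (simp add: e_def m_simps tensor_class_closed flip: zero_tensor_product)
    next
      case (diff v v')
      have "Poly_Mapping.keys (frag_of p) \<subseteq> carrier M \<times> carrier N"
        using frag_of by simp
      with diff.hyps have "cls (e (frag_of p) (v - v')) \<oplus>\<^bsub>T\<^esub> cls (e (v - v') (frag_of p)) =
          (cls (e (frag_of p) v) \<oplus>\<^bsub>T\<^esub> cls (e v (frag_of p))) \<oplus>\<^bsub>T\<^esub>
          (cls (e (frag_of p) v') \<oplus>\<^bsub>T\<^esub> cls (e v' (frag_of p)))"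
        by (simp add: e_diff cls_diff e_keys tensor_class_closed T.a_ac)
      also have "\<dots> = m (cls (frag_of p)) (cls v) \<oplus>\<^bsub>T\<^esub> m (cls (frag_of p)) (cls v')"
        by (simp only: diff.IH)
      finally show ?case
        using diff.hyps frag_of by (simp add: cls_diff m_simps tensor_class_closed)
    next
      case (frag_of q)
      have t: "cls (frag_of p) \<in> carrier T" "cls (frag_of q) \<in> carrier T"
        using frag_of \<open>p \<in> _\<close> by (simp_all add: tensor_class_closed)
      \<comment> \<open>For equal generators both terms on the left are the same \<open>Q\<close>
        value and cancel, in agreement with \<open>alt\<close>. For distinct ones exactly one term
        carries the value of \<open>m\<close>, possibly with its arguments exchanged, and the other
        is zero.\<close>
      show ?case
      proof (cases "p = q")
        case True
        then show ?thesis
          using frag_of alt Q by (auto simp: e_def h tensor_def)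
      next
        case False
        then show ?thesis
          using frag_of \<open>p \<in> _\<close> r_total [of p q] r_antisym [of p q] t sym
          by (auto simp: e_def h m_simps)
      qed
    qed
  qed
  define q where "q u = e u u" for u
  have q_keys: "Poly_Mapping.keys (q u) \<subseteq> carrier M \<times> carrier N"
    if "Poly_Mapping.keys u \<subseteq> carrier M \<times> carrier N" for u
    using that by (simp add: q_def e_keys)
  have q_frag_of: "cls (q (frag_of (x, y))) = Q x y" if "x \<in> carrier M" "y \<in> carrier N" for x y
    using that by (simp add: q_def e_def h)
  have q_uminus: "q (- u) = q u" for u
    using frag_extend2_diff_left [of h 0 u] frag_extend2_diff_right [of h u 0 u] by (simp add: q_def e_def)
  have q_add: "cls (q (u + v)) = cls (q u) \<oplus>\<^bsub>T\<^esub> cls (q v) \<oplus>\<^bsub>T\<^esub> m (cls u) (cls v)"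
    if u: "Poly_Mapping.keys u \<subseteq> carrier M \<times> carrier N" and v: "Poly_Mapping.keys v \<subseteq> carrier M \<times> carrier N" for u v
  proof -
    have "q (u + v) = (q u + q v) + (e u v + e v u)"
      by (simp add: q_def e_def frag_extend2_add_left frag_extend2_add_right)
    moreover have "Poly_Mapping.keys (q u + q v) \<subseteq> carrier M \<times> carrier N" "Poly_Mapping.keys (e u v + e v u) \<subseteq> carrier M \<times> carrier N"
      using u v by (simp_all add: keys_add_subset q_keys e_keys)
    ultimately show ?thesis
      using u v by (simp add: cls_add q_keys e_keys polar)
  qed
  have q_diff: "cls (q (u - v)) = cls (q u) \<oplus>\<^bsub>T\<^esub> cls (q v) \<oplus>\<^bsub>T\<^esub> m (cls u) (cls v)"
    if "Poly_Mapping.keys u \<subseteq> carrier M \<times> carrier N" "Poly_Mapping.keys v \<subseteq> carrier M \<times> carrier N" for u v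
    using q_add [of u "- v"] that by (simp add: q_uminus tensor_class_uminus tensor_class_closed)
  \<comment> \<open>Since \<open>a - b\<close> has the class of \<open>c\<close>, expanding with
    \<open>q_diff\<close> first gives \<open>q (a - b)\<close> the class of \<open>q c\<close>; the
    second difference then leaves twice that class and \<open>m (cls c) (cls c)\<close>.\<close>
  have q_rel: "cls (q (a - b - c)) = \<zero>\<^bsub>T\<^esub>"
    if keys: "Poly_Mapping.keys a \<subseteq> carrier M \<times> carrier N" "Poly_Mapping.keys b \<subseteq> carrier M \<times> carrier N"
      "Poly_Mapping.keys c \<subseteq> carrier M \<times> carrier N"
      and sum: "cls a = cls b \<oplus>\<^bsub>T\<^esub> cls c"
      and q_sum: "cls (q a) = cls (q b) \<oplus>\<^bsub>T\<^esub> cls (q c) \<oplus>\<^bsub>T\<^esub> m (cls b) (cls c)"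
      and zero: "m (cls b) (cls b) = \<zero>\<^bsub>T\<^esub>" "m (cls c) (cls c) = \<zero>\<^bsub>T\<^esub>" for a b c
  proof -
    have cl: "cls b \<in> carrier T" "cls c \<in> carrier T" "cls (q b) \<in> carrier T" "cls (q c) \<in> carrier T"
      using keys q_keys by (simp_all add: tensor_class_closed)
    have "Poly_Mapping.keys (a - b) \<subseteq> carrier M \<times> carrier N"
      using keys keys_diff [of a b] by blast
    moreover have "cls (a - b) = cls c"
      using keys cl by (simp add: cls_diff sum T.a_ac)
    ultimately show ?thesis
      using keys cl sym [of "cls c" "cls b"] by (simp add: q_diff q_sum sum zero m_simps T.a_ac)
  qed
  have q_kernel: "cls (q u) = \<zero>\<^bsub>T\<^esub>" if "u \<in> K" for u
    using that
  proof (induction rule: tensor_kernel_induct)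
    case zero
    show ?case
      by (simp add: q_def e_def zero_tensor_product)
  next
    case (rel r)
    then consider
        (l) x x' y where "r = frag_of (x \<oplus>\<^bsub>M\<^esub> x', y) - frag_of (x, y) - frag_of (x', y)"
          "x \<in> carrier M" "x' \<in> carrier M" "y \<in> carrier N"
      | (r) x y y' where "r = frag_of (x, y \<oplus>\<^bsub>N\<^esub> y') - frag_of (x, y) - frag_of (x, y')"
          "x \<in> carrier M" "y \<in> carrier N" "y' \<in> carrier N"
      | (b) c x y where "r = frag_of (c \<odot>\<^bsub>M\<^esub> x, y) - frag_of (x, c \<odot>\<^bsub>N\<^esub> y)"
          "c \<in> carrier R" "x \<in> carrier M" "y \<in> carrier N"
      unfolding tensor_relations_def by blast
    then show ?case
    proof cases
      case l
      then show ?thesis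
        unfolding l(1) by (intro q_rel)
          (simp_all add: q_frag_of Q_add_left alt tensor_add_left flip: tensor_def)
    next
      case r
      then show ?thesis
        unfolding r(1) by (intro q_rel)
          (simp_all add: q_frag_of Q_add_right alt tensor_add_right N_add_closed flip: tensor_def)
    next
      case b
      then show ?thesis
        by (simp add: q_diff q_frag_of Q_smult alt Q N_smult_closed tensor_smult_balanced flip: tensor_def)
    qed
  next
    case (minus u)
    then show ?case
      by (simp add: q_uminus)
  next
    case (add u v)
    then have "cls u = \<zero>\<^bsub>T\<^esub>" "cls v = \<zero>\<^bsub>T\<^esub>"
      by (simp_all add: tensor_class_zero_iff tensor_kernel_keys)
    with add show ?case
      by (simp add: q_add tensor_kernel_keys m_simps)
  qed
  define s where "s U = cls (q (rep U))" for U
  have s_cls: "s (cls u) = cls (q u)" if u: "Poly_Mapping.keys u \<subseteq> carrier M \<times> carrier N" for u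
  proof -
    \<comment> \<open>A quadratic map is well defined on cosets only if its polarisation also
      vanishes against \<open>K\<close>. Here it does, being \<open>m\<close> with a zero
      argument.\<close>
    have diff: "rep (cls u) - u \<in> K"
      using u by (rule rep_tensor_class_diff)
    then have "cls (q (u + (rep (cls u) - u))) = cls (q u) \<oplus>\<^bsub>T\<^esub> \<zero>\<^bsub>T\<^esub> \<oplus>\<^bsub>T\<^esub> m (cls u) \<zero>\<^bsub>T\<^esub>"
      using u diff tensor_kernel_keys [OF diff] tensor_class_zero_iff [OF tensor_kernel_keys [OF diff], THEN iffD2, OF diff]
      by (simp only: q_add q_kernel)
    then show ?thesis
      using u by (simp add: s_def m_simps tensor_class_closed q_keys)
  qed
  show ?thesis
  proof (intro exI conjI ballI)
    fix U assume "U \<in> carrier T"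
    then show "s U \<in> carrier T"
      by (simp add: s_def tensor_class_closed q_keys rep)
  next
    fix x y assume "x \<in> carrier M" "y \<in> carrier N"
    then show "s (tns x y) = Q x y"
      by (simp add: tensor_def s_cls q_frag_of)
  next
    fix U V assume "U \<in> carrier T" "V \<in> carrier T"
    then obtain u v where uv: "U = cls u" "V = cls v"
      "Poly_Mapping.keys u \<subseteq> carrier M \<times> carrier N" "Poly_Mapping.keys v \<subseteq> carrier M \<times> carrier N"
      by (auto simp: carrier_tensor_product)
    moreover have "Poly_Mapping.keys (u + v) \<subseteq> carrier M \<times> carrier N"
      using uv keys_add [of u v] by blast
    ultimately show "s (U \<oplus>\<^bsub>T\<^esub> V) = s U \<oplus>\<^bsub>T\<^esub> s V \<oplus>\<^bsub>T\<^esub> m U V"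
      by (simp add: s_cls q_add flip: tensor_class_add)
  qed
qed

end

section \<open>Induction over several tensors\<close>

context tensor_modules
begin

text \<open>The outer induction runs over \<open>U\<close>, the inner one over \<open>V\<close> with
  \<open>U\<close> elementary. In the case \<open>add_left\<close> the second argument is arbitrary,
  so axioms quadratic in the first argument can be treated there by their polarised form.\<close>

lemma tensor_product_induct2 [consumes 2, case_names tensor add_left add_right]:
  assumes "U \<in> carrier T" "V \<in> carrier T"
    and tensor: "\<And>x y x' y'. \<lbrakk>x \<in> carrier M; y \<in> carrier N; x' \<in> carrier M; y' \<in> carrier N\<rbrakk> \<Longrightarrow>
      P (tns x y) (tns x' y')"
    and add_left: "\<And>U U' V. \<lbrakk>U \<in> carrier T; U' \<in> carrier T; V \<in> carrier T; P U V; P U' V\<rbrakk> \<Longrightarrow>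
      P (U \<oplus>\<^bsub>T\<^esub> U') V"
    and add_right: "\<And>U V V'. \<lbrakk>U \<in> carrier T; V \<in> carrier T; V' \<in> carrier T; P U V; P U V'\<rbrakk> \<Longrightarrow>
      P U (V \<oplus>\<^bsub>T\<^esub> V')"
  shows "P U V"
  using assms(1)
proof (induction rule: tensor_product_induct)
  case (tensor x y)
  show ?case
    using assms(2) by (induction rule: tensor_product_induct)
      (auto intro: assms(3) add_right tensor_closed tensor)
qed (auto intro: add_left assms(2))

lemma tensor_product_induct3 [consumes 3, case_names tensor add1 add2 add3]:
  assumes "U \<in> carrier T" "V \<in> carrier T" "W \<in> carrier T"
    and tensor: "\<And>x y x' y' x'' y''. \<lbrakk>x \<in> carrier M; y \<in> carrier N; x' \<in> carrier M; y' \<in> carrier N;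
      x'' \<in> carrier M; y'' \<in> carrier N\<rbrakk> \<Longrightarrow> P (tns x y) (tns x' y') (tns x'' y'')"
    and add1: "\<And>U U' V W. \<lbrakk>U \<in> carrier T; U' \<in> carrier T; V \<in> carrier T; W \<in> carrier T;
      P U V W; P U' V W\<rbrakk> \<Longrightarrow> P (U \<oplus>\<^bsub>T\<^esub> U') V W"
    and add2: "\<And>U V V' W. \<lbrakk>U \<in> carrier T; V \<in> carrier T; V' \<in> carrier T; W \<in> carrier T;
      P U V W; P U V' W\<rbrakk> \<Longrightarrow> P U (V \<oplus>\<^bsub>T\<^esub> V') W"
    and add3: "\<And>U V W W'. \<lbrakk>U \<in> carrier T; V \<in> carrier T; W \<in> carrier T; W' \<in> carrier T;
      P U V W; P U V W'\<rbrakk> \<Longrightarrow> P U V (W \<oplus>\<^bsub>T\<^esub> W')"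
  shows "P U V W"
  using assms(1,2)
proof (induction rule: tensor_product_induct2)
  case (tensor x y x' y')
  show ?case
    using assms(3) by (induction rule: tensor_product_induct)
      (auto intro: assms(4) add3 tensor_closed tensor)
qed (auto intro: add1 add2 assms(3))

end

section \<open>The tensor product of an algebra with its derivations\<close>

context comm_assoc_algebra
begin

lemma a_distr_right:
  "\<lbrakk>x \<in> carrier A; y \<in> carrier A; z \<in> carrier A\<rbrakk> \<Longrightarrow> x \<otimes>\<^bsub>A\<^esub> (y \<oplus>\<^bsub>A\<^esub> z) = x \<otimes>\<^bsub>A\<^esub> y \<oplus>\<^bsub>A\<^esub> x \<otimes>\<^bsub>A\<^esub> z"
  by (simp add: a_mult_comm [of x] a_distr)

lemma a_smult_right:
  "\<lbrakk>c \<in> carrier R; x \<in> carrier A; y \<in> carrier A\<rbrakk> \<Longrightarrow> x \<otimes>\<^bsub>A\<^esub> (c \<odot>\<^bsub>A\<^esub> y) = c \<odot>\<^bsub>A\<^esub> (x \<otimes>\<^bsub>A\<^esub> y)"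
  by (simp add: a_mult_comm [of x] a_smult_assoc)

lemma a_zero_right: "x \<in> carrier A \<Longrightarrow> x \<otimes>\<^bsub>A\<^esub> \<zero>\<^bsub>A\<^esub> = \<zero>\<^bsub>A\<^esub>"
  using a_smult_right [of \<zero> x "\<zero>\<^bsub>A\<^esub>"] by (simp add: a_mult_closed)

lemma a_mult_lcomm:
  "\<lbrakk>x \<in> carrier A; y \<in> carrier A; z \<in> carrier A\<rbrakk> \<Longrightarrow> x \<otimes>\<^bsub>A\<^esub> (y \<otimes>\<^bsub>A\<^esub> z) = y \<otimes>\<^bsub>A\<^esub> (x \<otimes>\<^bsub>A\<^esub> z)"
  by (metis a_mult_assoc a_mult_comm)

lemmas a_mult_ac = a_mult_assoc a_mult_comm a_mult_lcomm

end

section \<open>Derivations in characteristic 2\<close>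

locale char2_derivations = comm_assoc_algebra R A for R (structure) and A (structure) +
  fixes D :: "('c \<Rightarrow> 'c) set"
  assumes field_R: "field R"
    and char2: "\<one> \<oplus> \<one> = \<zero>"
    and D: "restricted_lie_subalgebra_Der2 D R A"
begin

sublocale A: char2_abelian_group A
  by (rule char2_abelian_group [OF char2])

interpretation D: restricted_lie_subalgebra_Der2 D R A
  by (rule D)

abbreviation "DD \<equiv> subspace_of_Der R A D"

lemma carrier_DD [simp]: "carrier DD = D"
  by (simp add: subspace_of_Der_def)

lemma derivation_D: "f \<in> D \<Longrightarrow> f \<in> derivations R A"
  using D.subset by (auto simp: derivation_space_def)

lemma D_closed [simp]: "\<lbrakk>f \<in> D; x \<in> carrier A\<rbrakk> \<Longrightarrow> f x \<in> carrier A"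
  and D_add: "\<lbrakk>f \<in> D; x \<in> carrier A; y \<in> carrier A\<rbrakk> \<Longrightarrow> f (x \<oplus>\<^bsub>A\<^esub> y) = f x \<oplus>\<^bsub>A\<^esub> f y"
  and D_smult: "\<lbrakk>f \<in> D; c \<in> carrier R; x \<in> carrier A\<rbrakk> \<Longrightarrow> f (c \<odot>\<^bsub>A\<^esub> x) = c \<odot>\<^bsub>A\<^esub> f x"
  and D_mult: "\<lbrakk>f \<in> D; x \<in> carrier A; y \<in> carrier A\<rbrakk> \<Longrightarrow>
    f (x \<otimes>\<^bsub>A\<^esub> y) = f x \<otimes>\<^bsub>A\<^esub> y \<oplus>\<^bsub>A\<^esub> x \<otimes>\<^bsub>A\<^esub> f y"
  using derivation_D [of f] by (auto simp: derivations_def)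

text \<open>Derivations are extensional, so operator identities reduce to pointwise computations on
  the carrier.\<close>

lemma D_eqI:
  assumes "f \<in> D" "g \<in> D" "\<And>x. x \<in> carrier A \<Longrightarrow> f x = g x"
  shows "f = g"
  using assms derivation_D [of f] derivation_D [of g]
  by (intro PiE_ext [of f "carrier A" "\<lambda>_. carrier A" g]) (auto simp: derivations_def)

lemma add_DD: "f \<oplus>\<^bsub>DD\<^esub> g = (\<lambda>x\<in>carrier A. f x \<oplus>\<^bsub>A\<^esub> g x)"
  and smult_DD: "c \<odot>\<^bsub>DD\<^esub> f = (\<lambda>x\<in>carrier A. c \<odot>\<^bsub>A\<^esub> f x)"
  by (simp_all add: subspace_of_Der_def derivation_space_def)

lemma add_DD_apply [simp]: "x \<in> carrier A \<Longrightarrow> (f \<oplus>\<^bsub>DD\<^esub> g) x = f x \<oplus>\<^bsub>A\<^esub> g x"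
  and smult_DD_apply [simp]: "x \<in> carrier A \<Longrightarrow> (c \<odot>\<^bsub>DD\<^esub> f) x = c \<odot>\<^bsub>A\<^esub> f x"
  by (simp_all add: add_DD smult_DD)

lemma add_DD_closed [simp]: "\<lbrakk>f \<in> D; g \<in> D\<rbrakk> \<Longrightarrow> f \<oplus>\<^bsub>DD\<^esub> g \<in> D"
  using D.m_closed [of f g] by (simp add: subspace_of_Der_def)

lemma smult_DD_closed [simp]: "\<lbrakk>c \<in> carrier R; f \<in> D\<rbrakk> \<Longrightarrow> c \<odot>\<^bsub>DD\<^esub> f \<in> D"
  using D.smult_closed [of c f] by (simp add: subspace_of_Der_def)

abbreviation "comm \<equiv> commutator A"
abbreviation "square f \<equiv> compose (carrier A) f f"

lemma comm_closed [simp]: "\<lbrakk>f \<in> D; g \<in> D\<rbrakk> \<Longrightarrow> comm f g \<in> D"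
  by (rule D.commutator_closed)

lemma square_closed [simp]: "f \<in> D \<Longrightarrow> square f \<in> D"
  by (rule D.square_closed)

lemma comm_apply [simp]:
  "\<lbrakk>f \<in> D; g \<in> D; x \<in> carrier A\<rbrakk> \<Longrightarrow> comm f g x = f (g x) \<oplus>\<^bsub>A\<^esub> g (f x)"
  by (simp add: commutator_def)

lemma square_apply [simp]: "x \<in> carrier A \<Longrightarrow> square f x = f (f x)"
  by (simp add: compose_def)

lemma comm_sym: "\<lbrakk>f \<in> D; g \<in> D\<rbrakk> \<Longrightarrow> comm f g = comm g f"
  by (rule D_eqI) (auto intro: M.a_comm)

lemma comm_add_right:
  "\<lbrakk>f \<in> D; g \<in> D; g' \<in> D\<rbrakk> \<Longrightarrow> comm f (g \<oplus>\<^bsub>DD\<^esub> g') = comm f g \<oplus>\<^bsub>DD\<^esub> comm f g'"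
  by (rule D_eqI) (auto simp: D_add M.a_ac)

lemma comm_smult_right:
  "\<lbrakk>c \<in> carrier R; f \<in> D; g \<in> D\<rbrakk> \<Longrightarrow> comm f (c \<odot>\<^bsub>DD\<^esub> g) = c \<odot>\<^bsub>DD\<^esub> comm f g"
  by (rule D_eqI) (auto simp: D_smult smult_r_distr)

text \<open>The mixed terms \<open>fg + gf\<close> are the commutator because signs vanish.\<close>

lemma square_add:
  "\<lbrakk>f \<in> D; g \<in> D\<rbrakk> \<Longrightarrow> square (f \<oplus>\<^bsub>DD\<^esub> g) = square f \<oplus>\<^bsub>DD\<^esub> square g \<oplus>\<^bsub>DD\<^esub> comm f g"
  by (rule D_eqI) (auto simp: D_add M.a_ac)

lemma square_smult:
  "\<lbrakk>c \<in> carrier R; f \<in> D\<rbrakk> \<Longrightarrow> square (c \<odot>\<^bsub>DD\<^esub> f) = (c \<otimes> c) \<odot>\<^bsub>DD\<^esub> square f"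
  by (rule D_eqI) (auto simp: D_smult smult_assoc1)

text \<open>One term is isolated, as signs allow, so that \<open>tensor_add_right\<close> can split
  its tensor into the other two.\<close>

lemma comm_jacobi:
  "\<lbrakk>f \<in> D; g \<in> D; h \<in> D\<rbrakk> \<Longrightarrow> comm f (comm g h) = comm g (comm h f) \<oplus>\<^bsub>DD\<^esub> comm h (comm f g)"
  by (rule D_eqI) (auto simp: D_add M.a_ac)

text \<open>In the iterated commutator the composite \<open>fgf\<close> occurs twice and cancels,
  leaving \<open>ffg + gff\<close>.\<close>

lemma comm_square: "\<lbrakk>f \<in> D; g \<in> D\<rbrakk> \<Longrightarrow> comm (square f) g = comm f (comm f g)"
  by (rule D_eqI) (auto simp: D_add M.a_ac)

sublocale tensor_modules R A DD
  \<comment> \<open>\<open>D.one_closed\<close> refers to the additive monoid: the zero derivation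
    lies in \<open>D\<close> and makes the right factor nonempty.\<close>
  by unfold_locales (use D.one_closed in auto)

sublocale T: char2_abelian_group T
  by (rule T.char2_abelian_group [OF char2])

lemma tensor_closed' [simp]: "\<lbrakk>a \<in> carrier A; f \<in> D\<rbrakk> \<Longrightarrow> tns a f \<in> carrier T"
  by (simp add: tensor_closed)

text \<open>The derivation \<open>comm f f\<close> vanishes pointwise and hence equals its own
  double. Its tensor does too, and every double in \<open>T\<close> is zero.\<close>

lemma tensor_comm_self [simp]:
  assumes "a \<in> carrier A" "f \<in> D"
  shows "tns a (comm f f) = \<zero>\<^bsub>T\<^esub>"
proof -
  have "comm f f = comm f f \<oplus>\<^bsub>DD\<^esub> comm f f"
    using assms by (intro D_eqI) auto
  then have "tns a (comm f f) = tns a (comm f f) \<oplus>\<^bsub>T\<^esub> tns a (comm f f)"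
    using assms tensor_add_right [of a "comm f f" "comm f f"] by simp
  then show ?thesis
    using assms by simp
qed

section \<open>Existence and uniqueness of the operations\<close>

lemma bilinear_map_bracket_right:
  assumes "a \<in> carrier A" "f \<in> D"
  shows "bilinear_map (\<lambda>b g. tns (a \<otimes>\<^bsub>A\<^esub> b) (comm f g))"
  using assms by (simp add: bilinear_map_def a_mult_closed a_distr_right tensor_add_left
      comm_add_right tensor_add_right a_smult_right smult_tensor comm_smult_right
      flip: tensor_smult_balanced)

lemma bilinear_map_cong:
  "(\<And>x y. \<lbrakk>x \<in> carrier A; y \<in> D\<rbrakk> \<Longrightarrow> C x y = C' x y) \<Longrightarrow> bilinear_map C = bilinear_map C'"
  by (simp add: bilinear_map_def)

text \<open>In characteristic 2 the commutator is symmetric, as is the product of \<open>A\<close>,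
  so the two pairs of arguments may be exchanged.\<close>

lemma bilinear_map_bracket_left:
  assumes "b \<in> carrier A" "g \<in> D"
  shows "bilinear_map (\<lambda>a f. tns (a \<otimes>\<^bsub>A\<^esub> b) (comm f g))"
  using bilinear_map_bracket_right [OF assms] assms
  by (subst bilinear_map_cong [where C' = "\<lambda>a f. tns (b \<otimes>\<^bsub>A\<^esub> a) (comm g f)"])
    (simp_all add: a_mult_comm comm_sym)

lemma bilinear_map_product_right:
  assumes "a \<in> carrier A" "f \<in> D"
  shows "bilinear_map (\<lambda>b g. tns (a \<otimes>\<^bsub>A\<^esub> f b) g)"
  using assms by (simp add: bilinear_map_def a_mult_closed D_add D_smult a_distr_right tensor_add_left
      tensor_add_right a_smult_right smult_tensor flip: tensor_smult_balanced)

lemma bilinear_map_product_left: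
  assumes "b \<in> carrier A" "g \<in> D"
  shows "bilinear_map (\<lambda>a f. tns (a \<otimes>\<^bsub>A\<^esub> f b) g)"
  using assms by (simp add: bilinear_map_def a_mult_closed a_distr a_distr_right tensor_add_left
      a_smult_assoc a_smult_right smult_tensor)

lemma ex_tensor_Der_operations: "\<exists>br sq tri. tensor_Der_operations R A D br sq tri"
proof -
  obtain br where br: "bilinear_op R T br"
    and br_tns: "\<And>a f b g. \<lbrakk>a \<in> carrier A; f \<in> D; b \<in> carrier A; g \<in> D\<rbrakk> \<Longrightarrow>
      br (tns a f) (tns b g) = tns (a \<otimes>\<^bsub>A\<^esub> b) (comm f g)"
    using ex_bilinear_op [of "\<lambda>a f b g. tns (a \<otimes>\<^bsub>A\<^esub> b) (comm f g)"]
      bilinear_map_bracket_left bilinear_map_bracket_right by auto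
  obtain tri where tri: "bilinear_op R T tri"
    and tri_tns: "\<And>a f b g. \<lbrakk>a \<in> carrier A; f \<in> D; b \<in> carrier A; g \<in> D\<rbrakk> \<Longrightarrow>
      tri (tns a f) (tns b g) = tns (a \<otimes>\<^bsub>A\<^esub> f b) g"
    using ex_bilinear_op [of "\<lambda>a f b g. tns (a \<otimes>\<^bsub>A\<^esub> f b) g"]
      bilinear_map_product_left bilinear_map_product_right by auto
  have br_sym: "br U V = br V U" if "U \<in> carrier T" "V \<in> carrier T" for U V
    using that by (induction rule: tensor_product_induct2)
      (simp_all add: br_tns a_mult_comm comm_sym bilinear_opD(2,3) [OF br])
  have "\<exists>s. (\<forall>U\<in>carrier T. s U \<in> carrier T) \<and>
      (\<forall>a\<in>carrier A. \<forall>f\<in>carrier DD. s (tns a f) = tns (a \<otimes>\<^bsub>A\<^esub> a) (square f)) \<and>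
      (\<forall>U\<in>carrier T. \<forall>V\<in>carrier T. s (U \<oplus>\<^bsub>T\<^esub> V) = s U \<oplus>\<^bsub>T\<^esub> s V \<oplus>\<^bsub>T\<^esub> br U V)"
  proof (rule ex_quadratic_map [OF char2 br br_sym])
    \<comment> \<open>The cross term of the square is twice the product of \<open>a\<close> and
      \<open>a'\<close>, hence zero; the bracket term contains \<open>comm f f\<close> and vanishes
      as well.\<close>
    fix a a' f assume "a \<in> carrier A" "a' \<in> carrier A" "f \<in> carrier DD"
    then show "tns ((a \<oplus>\<^bsub>A\<^esub> a') \<otimes>\<^bsub>A\<^esub> (a \<oplus>\<^bsub>A\<^esub> a')) (square f) =
        tns (a \<otimes>\<^bsub>A\<^esub> a) (square f) \<oplus>\<^bsub>T\<^esub> tns (a' \<otimes>\<^bsub>A\<^esub> a') (square f) \<oplus>\<^bsub>T\<^esub> br (tns a f) (tns a' f)"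
      by (simp add: br_tns a_distr a_distr_right a_mult_closed a_mult_comm [of a' a] M.a_ac
          tensor_add_left T.a_comm)
  next
    \<comment> \<open>Both sides carry the scalar \<open>c \<otimes> c\<close>, coming from squaring
      on either factor.\<close>
    fix c a f assume "c \<in> carrier R" "a \<in> carrier A" "f \<in> carrier DD"
    then show "tns ((c \<odot>\<^bsub>A\<^esub> a) \<otimes>\<^bsub>A\<^esub> (c \<odot>\<^bsub>A\<^esub> a)) (square f) = tns (a \<otimes>\<^bsub>A\<^esub> a) (square (c \<odot>\<^bsub>DD\<^esub> f))"
      by (simp add: square_smult a_smult_assoc a_smult_right a_mult_closed
          flip: smult_assoc1 tensor_smult_balanced)
  \<comment> \<open>Additivity in the derivation is where a bracket term survives:
    \<open>square_add\<close> produces exactly \<open>comm f g\<close>.\<close>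
  qed (simp_all add: br_tns a_mult_closed square_add tensor_add_right)
  then obtain sq where "(\<forall>U\<in>carrier T. sq U \<in> carrier T) \<and>
      (\<forall>a\<in>carrier A. \<forall>f\<in>carrier DD. sq (tns a f) = tns (a \<otimes>\<^bsub>A\<^esub> a) (square f)) \<and>
      (\<forall>U\<in>carrier T. \<forall>V\<in>carrier T. sq (U \<oplus>\<^bsub>T\<^esub> V) = sq U \<oplus>\<^bsub>T\<^esub> sq V \<oplus>\<^bsub>T\<^esub> br U V)"
    by (elim exE)
  with br tri br_tns tri_tns have "tensor_Der_operations R A D br sq tri"
    by (simp add: tensor_Der_operations_def tensor_Der_def)
  then show ?thesis
    by blast
qed

lemma tensor_Der_operationsD:
  assumes "tensor_Der_operations R A D br sq tri"
  shows "bilinear_op R T br" "bilinear_op R T tri"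
    and "\<lbrakk>a \<in> carrier A; f \<in> D; b \<in> carrier A; g \<in> D\<rbrakk> \<Longrightarrow>
      br (tns a f) (tns b g) = tns (a \<otimes>\<^bsub>A\<^esub> b) (comm f g)"
    and "\<lbrakk>a \<in> carrier A; f \<in> D; b \<in> carrier A; g \<in> D\<rbrakk> \<Longrightarrow>
      tri (tns a f) (tns b g) = tns (a \<otimes>\<^bsub>A\<^esub> f b) g"
    and "U \<in> carrier T \<Longrightarrow> sq U \<in> carrier T"
    and "\<lbrakk>a \<in> carrier A; f \<in> D\<rbrakk> \<Longrightarrow> sq (tns a f) = tns (a \<otimes>\<^bsub>A\<^esub> a) (square f)"
    and "\<lbrakk>U \<in> carrier T; V \<in> carrier T\<rbrakk> \<Longrightarrow> sq (U \<oplus>\<^bsub>T\<^esub> V) = sq U \<oplus>\<^bsub>T\<^esub> sq V \<oplus>\<^bsub>T\<^esub> br U V"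
  using assms by (simp_all add: tensor_Der_operations_def tensor_Der_def)

text \<open>Biadditive maps are determined by elementary tensors. The 2-map is so as well, since its
  defect of additivity is the bracket, whose uniqueness is settled first.\<close>

lemma tensor_Der_operations_unique:
  assumes "tensor_Der_operations R A D br sq tri" "tensor_Der_operations R A D br' sq' tri'"
    and "U \<in> carrier T" "V \<in> carrier T"
  shows "br U V = br' U V" "sq U = sq' U" "tri U V = tri' U V"
proof -
  note ops = tensor_Der_operationsD [OF assms(1)] and ops' = tensor_Der_operationsD [OF assms(2)]
  have br: "br U V = br' U V" if "U \<in> carrier T" "V \<in> carrier T" for U V
    using that by (induction rule: tensor_product_induct2)
      (simp_all add: ops ops' bilinear_opD(2,3) [OF ops(1)] bilinear_opD(2,3) [OF ops'(1)])
  show "br U V = br' U V"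
    using assms(3,4) by (rule br)
  show "tri U V = tri' U V"
    using assms(3,4) by (induction rule: tensor_product_induct2)
      (simp_all add: ops ops' bilinear_opD(2,3) [OF ops(2)] bilinear_opD(2,3) [OF ops'(2)])
  show "sq U = sq' U"
    using assms(3) by (induction rule: tensor_product_induct) (simp_all add: ops ops' br)
qed

lemma trivially_restricted_post_lie:
  assumes "tensor_Der_operations R A D br sq tri"
  shows "trivially_restricted_post_lie_algebra2 R T br sq tri"
proof -
  note ops = tensor_Der_operationsD [OF assms]
  note br = bilinear_opD [OF ops(1)] and tri = bilinear_opD [OF ops(2)]
  note tns_simps = ops(3,4,6) a_mult_closed
  have br_sym: "br U V = br V U" if "U \<in> carrier T" "V \<in> carrier T" for U V
    using that by (induction rule: tensor_product_induct2)
      (simp_all add: tns_simps br a_mult_comm comm_sym)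
  have alternating: "br U U = \<zero>\<^bsub>T\<^esub>" if "U \<in> carrier T" for U
    using that
  proof (induction rule: tensor_product_induct)
    case (add U V)
    then show ?case
      using br_sym [of U V] by (simp add: br)
  qed (simp add: tns_simps)
  have jacobi: "br U (br V W) \<oplus>\<^bsub>T\<^esub> br V (br W U) \<oplus>\<^bsub>T\<^esub> br W (br U V) = \<zero>\<^bsub>T\<^esub>"
    if "U \<in> carrier T" "V \<in> carrier T" "W \<in> carrier T" for U V W
    using that
  proof (induction rule: tensor_product_induct3)
    case (tensor a f b g c h)
    \<comment> \<open>The three cyclic products in \<open>A\<close> agree, which leaves the Jacobi
      identity for derivations in the right factor.\<close>
    then have "b \<otimes>\<^bsub>A\<^esub> (c \<otimes>\<^bsub>A\<^esub> a) = a \<otimes>\<^bsub>A\<^esub> (b \<otimes>\<^bsub>A\<^esub> c)" "c \<otimes>\<^bsub>A\<^esub> (a \<otimes>\<^bsub>A\<^esub> b) = a \<otimes>\<^bsub>A\<^esub> (b \<otimes>\<^bsub>A\<^esub> c)"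
      by (simp_all add: a_mult_ac)
    with tensor show ?case
      using comm_jacobi [of f g h] by (simp add: tns_simps tensor_add_right T.a_ac)
  next
    case (add1 U U' V W)
    \<comment> \<open>The Jacobi expression is additive in each variable: the sum of its values for
      two summands, zero by induction, is regrouped into its value for their sum. The other two
      cases are alike.\<close>
    have "(br U (br V W) \<oplus>\<^bsub>T\<^esub> br V (br W U) \<oplus>\<^bsub>T\<^esub> br W (br U V)) \<oplus>\<^bsub>T\<^esub>
        (br U' (br V W) \<oplus>\<^bsub>T\<^esub> br V (br W U') \<oplus>\<^bsub>T\<^esub> br W (br U' V)) = \<zero>\<^bsub>T\<^esub>"
      by (simp only: add1 T.r_zero T.zero_closed)
    then show ?case
      using add1(1-4) by (simp add: br T.a_ac)
  next
    case (add2 U V V' W)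
    have "(br U (br V W) \<oplus>\<^bsub>T\<^esub> br V (br W U) \<oplus>\<^bsub>T\<^esub> br W (br U V)) \<oplus>\<^bsub>T\<^esub>
        (br U (br V' W) \<oplus>\<^bsub>T\<^esub> br V' (br W U) \<oplus>\<^bsub>T\<^esub> br W (br U V')) = \<zero>\<^bsub>T\<^esub>"
      by (simp only: add2 T.r_zero T.zero_closed)
    then show ?case
      using add2(1-4) by (simp add: br T.a_ac)
  next
    case (add3 U V W W')
    have "(br U (br V W) \<oplus>\<^bsub>T\<^esub> br V (br W U) \<oplus>\<^bsub>T\<^esub> br W (br U V)) \<oplus>\<^bsub>T\<^esub>
        (br U (br V W') \<oplus>\<^bsub>T\<^esub> br V (br W' U) \<oplus>\<^bsub>T\<^esub> br W' (br U V)) = \<zero>\<^bsub>T\<^esub>"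
      by (simp only: add3 T.r_zero T.zero_closed)
    then show ?case
      using add3(1-4) by (simp add: br T.a_ac)
  qed
  \<comment> \<open>The Jacobi identity in the form of the polarisation of
    \<open>br (sq U) W = br U (br U W)\<close>, as needed for sums in the first argument.\<close>
  have br_br: "br (br U V) W = br U (br V W) \<oplus>\<^bsub>T\<^esub> br V (br U W)"
    if "U \<in> carrier T" "V \<in> carrier T" "W \<in> carrier T" for U V W
  proof -
    have "br W (br U V) = br U (br V W) \<oplus>\<^bsub>T\<^esub> br V (br W U)"
      using jacobi [OF that] that T.minus_equality [of "br U (br V W) \<oplus>\<^bsub>T\<^esub> br V (br W U)" "br W (br U V)"]
      by (simp add: br)
    then show ?thesis
      using that br_sym [of W "br U V"] br_sym [of W U] by (simp add: br)
  qed
  \<comment> \<open>On elementary tensors this is the Leibniz rule for \<open>f\<close> on a product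
    \<open>bc\<close>. It is also the polarisation of the axiom \<open>tri_sq_right\<close>.\<close>
  have tri_br_right: "tri U (br V W) = br (tri U V) W \<oplus>\<^bsub>T\<^esub> br V (tri U W)"
    if "U \<in> carrier T" "V \<in> carrier T" "W \<in> carrier T" for U V W
    using that
  proof (induction rule: tensor_product_induct3)
    case (tensor a f b g c h)
    then show ?case
      by (simp add: tns_simps D_mult a_distr_right tensor_add_left a_mult_ac)
  qed (simp_all add: br tri T.a_ac)
  \<comment> \<open>For elementary tensors the Leibniz term \<open>a f(b) g(c)\<close> cancels
    within each associator; what remains, \<open>ab f(g(c))\<close> and \<open>ab g(f(c))\<close>,
    adds up to the commutator. This also polarises \<open>tri_sq_left\<close>.\<close>
  have tri_br_left: "tri (br U V) W =
      (tri U (tri V W) \<oplus>\<^bsub>T\<^esub> tri (tri U V) W) \<oplus>\<^bsub>T\<^esub> (tri V (tri U W) \<oplus>\<^bsub>T\<^esub> tri (tri V U) W)"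
    if "U \<in> carrier T" "V \<in> carrier T" "W \<in> carrier T" for U V W
    using that
  proof (induction rule: tensor_product_induct3)
    case (tensor a f b g c h)
    then show ?case
      by (simp add: tns_simps D_mult a_distr_right tensor_add_left a_mult_ac T.a_ac)
  qed (simp_all add: br tri T.a_ac)
  show ?thesis
  proof (intro trivially_restricted_post_lie_algebra2.intro restricted_lie_algebra2.intro
      post_lie_algebra.intro lie_algebra.intro module_tensor_product
      trivially_restricted_post_lie_algebra2_axioms.intro restricted_lie_algebra2_axioms.intro
      post_lie_algebra_axioms.intro lie_algebra_axioms.intro field_R char2 ops(1,2,5,7) alternating jacobi)
    fix c U assume c: "c \<in> carrier R" and U: "U \<in> carrier T"
    show "sq (c \<odot>\<^bsub>T\<^esub> U) = (c \<otimes> c) \<odot>\<^bsub>T\<^esub> sq U"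
      using U
    proof (induction rule: tensor_product_induct)
      case (tensor a f)
      then show ?case
        using c by (simp add: smult_tensor tns_simps a_smult_assoc a_smult_right smult_assoc1)
    next
      case (add U V)
      then show ?case
        using c by (simp add: T.smult_r_distr ops br T.smult_assoc1)
    qed
  next
    fix U V assume "U \<in> carrier T" "V \<in> carrier T"
    then show "br (sq U) V = br U (br U V)"
    proof (induction rule: tensor_product_induct2)
      case (tensor a f b g)
      then show ?case
        by (simp add: tns_simps a_mult_assoc comm_square)
    next
      case (add_left U U' V)
      then show ?case
        by (simp add: ops br br_br T.a_ac)
    qed (simp add: ops br)
  next
    fix U V W assume "U \<in> carrier T" "V \<in> carrier T" "W \<in> carrier T"
    then show "tri U (br V W) = br (tri U V) W \<oplus>\<^bsub>T\<^esub> br V (tri U W)"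
      by (rule tri_br_right)
  next
    fix U V W assume "U \<in> carrier T" "V \<in> carrier T" "W \<in> carrier T"
    then show "tri (br U V) W = tri_associator T tri U V W \<ominus>\<^bsub>T\<^esub> tri_associator T tri V U W"
      by (simp add: tri_associator_def tri tri_br_left)
  next
    fix U V assume "U \<in> carrier T" "V \<in> carrier T"
    \<comment> \<open>The identity is quadratic in \<open>V\<close> and linear in \<open>U\<close>,
      so the facts are swapped to run the outer induction over \<open>V\<close>.\<close>
    from this(2,1) show "tri U (sq V) = br (tri U V) V"
    proof (induction rule: tensor_product_induct2)
      case (tensor b g a f)
      then show ?case
        by (simp add: tns_simps D_mult a_mult_comm [of "f b" b] a_zero_right tensor_zero_left)
    next
      case (add_left V V' U)
      then show ?case
        using br_sym [of V "tri U V'"] br_sym [of V' "tri U V"] by (simp add: ops br tri tri_br_right T.a_ac)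
    qed (simp add: ops br tri)
  next
    fix U V assume "U \<in> carrier T" "V \<in> carrier T"
    then show "tri (sq U) V = tri U (tri U V) \<oplus>\<^bsub>T\<^esub> tri (tri U U) V"
    proof (induction rule: tensor_product_induct2)
      \<comment> \<open>Applying \<open>f\<close> to the product of \<open>a\<close> and
        \<open>f b\<close> yields the extra term \<open>a f(a) f(b)\<close>, which
        \<open>tri (tri U U) V\<close> cancels.\<close>
      case (tensor a f b g)
      then show ?case
        by (simp add: tns_simps D_mult a_distr_right tensor_add_left a_mult_ac T.a_ac)
    next
      case (add_left U U' V)
      then show ?case
        by (simp add: ops br tri tri_br_left T.a_ac)
    next
      case (add_right U V V')
      then show ?case
        by (simp add: ops br tri T.a_ac)
    qed
  qed
qed

end

text \<open>The operations are prescribed by conditions on elementary tensors and extension rules.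
  Existence keeps the final clause from being vacuous, and uniqueness on the carrier makes it a
  statement about one definite structure.\<close>

theorem proposition3p3p7:
  fixes k :: "('k, 'm) ring_scheme"
    and A :: "('k, 'a, 'n) module_scheme"
    and D :: "('a \<Rightarrow> 'a) set"
  assumes "field k"
    and "\<one>\<^bsub>k\<^esub> \<oplus>\<^bsub>k\<^esub> \<one>\<^bsub>k\<^esub> = \<zero>\<^bsub>k\<^esub>"
    and "comm_assoc_algebra k A"
    and "restricted_lie_subalgebra_Der2 D k A"
  shows "(\<exists>br sq tri. tensor_Der_operations k A D br sq tri) \<and>
    (\<forall>br sq tri br' sq' tri'.
      tensor_Der_operations k A D br sq tri \<longrightarrow> tensor_Der_operations k A D br' sq' tri' \<longrightarrow>
      (\<forall>u\<in>carrier (tensor_Der k A D). \<forall>v\<in>carrier (tensor_Der k A D).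
        br u v = br' u v \<and> sq u = sq' u \<and> tri u v = tri' u v)) \<and>
    (\<forall>br sq tri. tensor_Der_operations k A D br sq tri \<longrightarrow>
      trivially_restricted_post_lie_algebra2 k (tensor_Der k A D) br sq tri)"
proof -
  interpret char2_derivations k A D
    by (intro char2_derivations.intro char2_derivations_axioms.intro assms)
  show ?thesis
    unfolding tensor_Der_def
    by (intro conjI allI impI ballI ex_tensor_Der_operations trivially_restricted_post_lie)
      (erule (3) tensor_Der_operations_unique)+
qed

end
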